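(* Let $k\leq m\leq n$ be integers and $\epsilon>0$ be such that $k/\epsilon=O(\min(m,n^{1/3}))$. Any randomized and possibly adaptive algorithm that, given query access to the entries of a distance matrix $A\in\mathbb R^{n\times m}$, computes $V\in\mathbb R^{n\times k}$, $U\in\mathbb R^{k\times m}$ satisfying $\|A-VU\|_F^2 \leq \|A-A_k\|_F^2+\epsilon\|A\|_F^2$, must read at least $\Omega((n+m)k/\epsilon)$ entries of $A$ in expectation. This lower bound holds even when restricted to symmetric distance matrices.
   Context: A matrix $A\in\mathbb R^{n\times m}$ is a distance matrix if there is a metric space $(\mathcal Z,\mathrm d)$ and points $x_1,\dots,x_n,y_1,\dots,y_m\in\mathcal Z$ with $A_{ij}=\mathrm d(x_i,y_j)$ for all $i,j$; it is symmetric if $n=m$ and $x_i=y_i$ for all $i$. $A_k$ denotes an optimal rank-$k$ approximation of $A$ in Frobenius norm.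
   Formalization: The bound is stated for ε at most a positive threshold depending only on the constant hidden in k/ε = O(min(m, n^{1/3})); for arbitrary ε > 0 it fails, since for ε ≥ 1 the choice V = 0, U = 0 meets the requirement without reading any entry. *)

theory Defs
  imports
    "HOL-Analysis.Abstract_Metric_Spaces"
    "HOL-Probability.Probability_Measure"
    "Jordan_Normal_Form.DL_Rank"
begin

(* Only the n + m points x_0,...,x_(n-1), y_0,...,y_(m-1) matter, so fixing the type nat for the
   points of the ambient metric space loses no generality: the subspace formed by these points
   is finite, hence isometric to a metric space on a set of natural numbers.
   The points need not be distinct.  Matrix indices start at 0. *)
definition distance_mats :: "nat \<Rightarrow> nat \<Rightarrow> real mat set" where
  "distance_mats n m = {A \<in> carrier_mat n m.
     \<exists>(Z :: nat set) d x y. Metric_space Z d \<and> (\<forall>i<n. x i \<in> Z) \<and> (\<forall>j<m. y j \<in> Z) \<and>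
       (\<forall>i<n. \<forall>j<m. A $$ (i, j) = d (x i) (y j))}"

definition symmetric_distance_mats :: "nat \<Rightarrow> real mat set" where
  "symmetric_distance_mats n = {A \<in> carrier_mat n n.
     \<exists>(Z :: nat set) d x. Metric_space Z d \<and> (\<forall>i<n. x i \<in> Z) \<and>
       (\<forall>i<n. \<forall>j<n. A $$ (i, j) = d (x i) (x j))}"

definition frobenius_norm :: "real mat \<Rightarrow> real" where
  "frobenius_norm A = sqrt (\<Sum>i<dim_row A. \<Sum>j<dim_col A. (A $$ (i, j))\<^sup>2)"

definition rank_at_most :: "nat \<Rightarrow> nat \<Rightarrow> nat \<Rightarrow> real mat set" where
  "rank_at_most n m k = {B \<in> carrier_mat n m. vec_space.rank n B \<le> k}"

(* B is a possible choice of A_k. *)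
definition optimal_rank_approx :: "nat \<Rightarrow> real mat \<Rightarrow> real mat \<Rightarrow> bool" where
  "optimal_rank_approx k A B \<longleftrightarrow>
     B \<in> rank_at_most (dim_row A) (dim_col A) k \<and>
     (\<forall>C \<in> rank_at_most (dim_row A) (dim_col A) k.
        frobenius_norm (A - B) \<le> frobenius_norm (A - C))"

(* A_k always exists but need not be unique; the value of the norm of A - A_k does not depend
   on the choice, so it does not matter which optimal B is used. *)
definition good_low_rank_approx :: "nat \<Rightarrow> real \<Rightarrow> real mat \<Rightarrow> real mat \<Rightarrow> real mat \<Rightarrow> bool" where
  "good_low_rank_approx k \<epsilon> A V U \<longleftrightarrow>
     V \<in> carrier_mat (dim_row A) k \<and> U \<in> carrier_mat k (dim_col A) \<and>
     (\<exists>B. optimal_rank_approx k A B \<and>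
        (frobenius_norm (A - V * U))\<^sup>2
          \<le> (frobenius_norm (A - B))\<^sup>2 + \<epsilon> * (frobenius_norm A)\<^sup>2)"

(* Deterministic adaptive query algorithms as decision trees: Query i j f reads entry (i, j) and
   continues with f applied to the value found; Output V U stops.  Every branch is finite, which
   loses nothing: an algorithm knows its input after n * m distinct reads, and only these are
   counted below. *)
datatype query_alg =
    Output "real mat" "real mat"
  | Query nat nat "real \<Rightarrow> query_alg"

primrec queries_within :: "nat \<Rightarrow> nat \<Rightarrow> query_alg \<Rightarrow> bool" where
  "queries_within n m (Output V U) \<longleftrightarrow> True"
| "queries_within n m (Query i j f) \<longleftrightarrow> i < n \<and> j < m \<and> (\<forall>a. queries_within n m (f a))"

primrec run :: "real mat \<Rightarrow> query_alg \<Rightarrow> real mat \<times> real mat" where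
  "run A (Output V U) = (V, U)"
| "run A (Query i j f) = run A (f (A $$ (i, j)))"

primrec entries_read :: "real mat \<Rightarrow> query_alg \<Rightarrow> (nat \<times> nat) set" where
  "entries_read A (Output V U) = {}"
| "entries_read A (Query i j f) = insert (i, j) (entries_read A (f (A $$ (i, j))))"

definition num_reads :: "real mat \<Rightarrow> query_alg \<Rightarrow> nat" where
  "num_reads A T = card (entries_read A T)"

(* A randomized algorithm is a probability measure on deterministic ones.  The sigma-algebra is
   arbitrary, subject only to the number of reads being a random variable on every input from the
   class; so every way of drawing a decision tree from some probability space is covered,
   by taking the push-forward measure. *)
definition randomized_alg :: "nat \<Rightarrow> nat \<Rightarrow> real mat set \<Rightarrow> query_alg measure \<Rightarrow> bool" where
  "randomized_alg n m \<A> M \<longleftrightarrow>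
     prob_space M \<and> (\<forall>T \<in> space M. queries_within n m T) \<and>
     (\<forall>A \<in> \<A>. num_reads A \<in> measurable M (count_space UNIV))"

(* Success with the customary probability 2/3 over the coins, on each input of the class. *)
definition solves_low_rank_approx ::
    "nat \<Rightarrow> real \<Rightarrow> real mat set \<Rightarrow> query_alg measure \<Rightarrow> bool" where
  "solves_low_rank_approx k \<epsilon> \<A> M \<longleftrightarrow>
     (\<forall>A \<in> \<A>.
        {T \<in> space M. case run A T of (V, U) \<Rightarrow> good_low_rank_approx k \<epsilon> A V U} \<in> sets M \<and>
        measure M {T \<in> space M. case run A T of (V, U) \<Rightarrow> good_low_rank_approx k \<epsilon> A V U} \<ge> 2 / 3)"

definition expected_reads :: "query_alg measure \<Rightarrow> real mat \<Rightarrow> real" where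
  "expected_reads M A = (LINT T|M. real (num_reads A T))"

(* Every algorithm that is correct on the class of n x m matrices \<A> needs at least q reads
   in expectation on some input of the class. *)
definition query_lower_bound ::
    "nat \<Rightarrow> nat \<Rightarrow> nat \<Rightarrow> real \<Rightarrow> real mat set \<Rightarrow> real \<Rightarrow> bool" where
  "query_lower_bound n m k \<epsilon> \<A> q \<longleftrightarrow>
     (\<forall>M. randomized_alg n m \<A> M \<and> solves_low_rank_approx k \<epsilon> \<A> M \<longrightarrow>
        (\<exists>A \<in> \<A>. expected_reads M A \<ge> q))"

end

theory Submission
  imports Defs
begin

text \<open>Hide independent uniform signs \<open>s\<^sub>i\<^sub>b\<close>, one for each row \<open>i\<close> and each of \<open>k\<close> classes \<open>b\<close> of columns, and
  let the entry \<open>(i, j)\<close> be \<open>1\<close> or \<open>2\<close> with mean \<open>3 / 2 + \<eta> / 2 * s\<^sub>i\<^sub>b\<close>, where \<open>j\<close> lies in class \<open>b\<close> and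
  \<open>\<eta>\<^sup>2\<close> is a large multiple of \<open>\<epsilon>\<close>. Every matrix with entries in \<open>[1, 2]\<close> is a distance matrix. The matrix \<open>E\<close> of
  the means has rank \<open>k\<close>, and the noise \<open>A - E\<close> has so small an operator norm (second moments of the
  Gram matrix suffice, and this is where \<open>k / \<epsilon> = O(min(m, n\<^bsup>1/3\<^esup>))\<close> enters) that it is nearly
  orthogonal to all matrices of rank \<open>2 k\<close>. So a good rank-\<open>k\<close> approximation is close to \<open>E\<close>, and it
  reveals most of the \<open>n k\<close> signs. But a read entry carries only \<open>O(\<eta>\<^sup>2)\<close> information about a single
  sign, whence \<open>\<Omega>(n k / \<eta>\<^sup>2)\<close> reads.

  In the symmetric case such a matrix is put into the off-diagonal blocks, the other blocks being constant
  apart from the zero diagonal; the number of its rows is a small constant fraction of \<open>n\<close>.\<close>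

section \<open>Sums of outer products\<close>

definition outer_rank :: "nat \<Rightarrow> (nat \<Rightarrow> nat \<Rightarrow> real) \<Rightarrow> bool" where
  "outer_rank r D \<longleftrightarrow> (\<exists>x y. \<forall>i j. D i j = (\<Sum>l<r. x l i * y l j))"

lemma outer_rankI: "(\<And>i j. D i j = (\<Sum>l<r. x l i * y l j)) \<Longrightarrow> outer_rank r D"
  unfolding outer_rank_def by blast

lemma outer_rank_rank_one: "outer_rank 1 (\<lambda>i j. f i * g j)"
  by (rule outer_rankI[where x = "\<lambda>_. f" and y = "\<lambda>_. g"]) simp

lemma outer_rank_selected_column:
  assumes "\<And>j. g j < r"
  shows "outer_rank r (\<lambda>i j. f i (g j))"
proof (rule outer_rankI[where x = "\<lambda>l i. f i l" and y = "\<lambda>l j. of_bool (g j = l)"])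
  fix i j
  have "(\<Sum>l<r. f i l * of_bool (g j = l)) = (\<Sum>l<r. if g j = l then f i l else 0)"
    by (rule sum.cong) auto
  then show "f i (g j) = (\<Sum>l<r. f i l * of_bool (g j = l))"
    using assms[of j] by simp
qed

lemma outer_rank_scale_both:
  assumes "outer_rank r D"
  shows "outer_rank r (\<lambda>i j. a i * b j * D i j)"
proof -
  obtain x y where "\<forall>i j. D i j = (\<Sum>l<r. x l i * y l j)"
    using assms unfolding outer_rank_def by blast
  then show ?thesis
    by (intro outer_rankI[where x = "\<lambda>l i. a i * x l i" and y = "\<lambda>l j. b j * y l j"])
      (simp add: sum_distrib_left algebra_simps)
qed

lemma outer_rank_reindex:
  assumes "outer_rank r D"
  shows "outer_rank r (\<lambda>i j. D (f i) (g j))"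
proof -
  obtain x y where "\<forall>i j. D i j = (\<Sum>l<r. x l i * y l j)"
    using assms unfolding outer_rank_def by blast
  then show ?thesis
    by (intro outer_rankI[where x = "\<lambda>l i. x l (f i)" and y = "\<lambda>l j. y l (g j)"]) simp
qed

lemma outer_rank_transpose:
  assumes "outer_rank r D"
  shows "outer_rank r (\<lambda>i j. D j i)"
proof -
  obtain x y where "\<forall>i j. D i j = (\<Sum>l<r. x l i * y l j)"
    using assms unfolding outer_rank_def by blast
  then show ?thesis
    by (intro outer_rankI[where x = y and y = x]) (simp add: mult.commute)
qed

lemma outer_rank_add:
  assumes "outer_rank r D" "outer_rank r' D'"
  shows "outer_rank (r + r') (\<lambda>i j. D i j + D' i j)"
proof -
  obtain x y where xy: "\<forall>i j. D i j = (\<Sum>l<r. x l i * y l j)"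
    using assms unfolding outer_rank_def by blast
  obtain x' y' where xy': "\<forall>i j. D' i j = (\<Sum>l<r'. x' l i * y' l j)"
    using assms unfolding outer_rank_def by blast
  have split: "(\<Sum>l<r + r'. g l) = (\<Sum>l<r. g l) + (\<Sum>l<r'. g (r + l))" for g :: "nat \<Rightarrow> real"
    by (induction r') auto
  show ?thesis
    by (rule outer_rankI[where x = "\<lambda>l. if l < r then x l else x' (l - r)"
          and y = "\<lambda>l. if l < r then y l else y' (l - r)"])
      (simp add: xy xy' split)
qed

lemma outer_rank_mono:
  assumes "outer_rank r D" "r \<le> r'"
  shows "outer_rank r' D"
proof -
  have "outer_rank (r' - r) (\<lambda>_ _. 0)"
    by (rule outer_rankI[where x = "\<lambda>_ _. 0" and y = "\<lambda>_ _. 0"]) simp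
  from outer_rank_add[OF assms(1) this] assms(2) show ?thesis by simp
qed

lemma outer_rank_uminus: "outer_rank r D \<Longrightarrow> outer_rank r (\<lambda>i j. - D i j)"
  using outer_rank_scale_both[of r D "\<lambda>_. -1" "\<lambda>_. 1"] by simp

lemma rank_le_outer_rank:
  assumes "outer_rank r D"
  shows "mat n m (\<lambda>(i, j). D i j) \<in> rank_at_most n m r"
proof -
  obtain x y where xy: "\<And>i j. D i j = (\<Sum>l<r. x l i * y l j)"
    using assms unfolding outer_rank_def by blast
  have "vec_space.rank n (mat n m (\<lambda>(i, j). \<Sum>l<r. x l i * y l j)) \<le> r"
  proof (induction r)
    case 0
    have *: "mat n m (\<lambda>(i, j). \<Sum>l<0. x l i * y l j) = 0\<^sub>m n m" by auto
    show ?case unfolding * vec_space.rank_0I by simp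
  next
    case (Suc r)
    let ?P = "mat n m (\<lambda>(i, j). \<Sum>l<r. x l i * y l j)" and ?Q = "mat n m (\<lambda>(i, j). x r i * y r j)"
    have "mat n m (\<lambda>(i, j). \<Sum>l<Suc r. x l i * y l j) = ?P + ?Q" by auto
    moreover have "vec_space.rank n (?P + ?Q) \<le> vec_space.rank n ?P + vec_space.rank n ?Q"
      by (rule vec_space.rank_subadditive) auto
    moreover have "vec_space.rank n ?Q \<le> 1"
      by (rule vec_space.rank_le_1_product_entries[where f = "x r" and g = "y r"]) auto
    ultimately show ?case using Suc by simp
  qed
  then show ?thesis unfolding rank_at_most_def by (simp add: xy)
qed

lemma outer_rank_mult_mat:
  assumes "V \<in> carrier_mat n k" "U \<in> carrier_mat k m"
  obtains D where "outer_rank k D" "\<And>i j. i < n \<Longrightarrow> j < m \<Longrightarrow> D i j = (V * U) $$ (i, j)"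
proof
  show "outer_rank k (\<lambda>i j. \<Sum>l<k. V $$ (i, l) * U $$ (l, j))"
    by (rule outer_rankI) (rule refl)
  show "(\<Sum>l<k. V $$ (i, l) * U $$ (l, j)) = (V * U) $$ (i, j)" if "i < n" "j < m" for i j
    using assms that by (simp add: scalar_prod_def atLeast0LessThan)
qed

text \<open>Replacing \<open>y\<^sub>r\<close> by its component orthogonal to the others and
  correcting the other left factors is Gram--Schmidt; vanishing factors are allowed.\<close>
lemma outer_rank_orthogonal:
  assumes "outer_rank r D"
  obtains x y where "\<And>i j. j < q \<Longrightarrow> D i j = (\<Sum>l<r. x l i * y l j)"
    "\<And>l l'. l < r \<Longrightarrow> l' < r \<Longrightarrow> l \<noteq> l' \<Longrightarrow> (\<Sum>j<(q::nat). y l j * y l' j) = 0"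
proof -
  obtain x y where xy: "\<And>i j. D i j = (\<Sum>l<r. x l i * y l j)"
    using assms unfolding outer_rank_def by blast
  have "\<exists>x' y'. (\<forall>i. \<forall>j<q. (\<Sum>l<r. x l i * y l j) = (\<Sum>l<r. x' l i * y' l j)) \<and>
     (\<forall>l<r. \<forall>l'<r. l \<noteq> l' \<longrightarrow> (\<Sum>j<q. y' l j * y' l' j) = 0)"
  proof (induction r)
    case 0
    then show ?case by simp
  next
    case (Suc r)
    then obtain u v where uv: "\<And>i j. j < q \<Longrightarrow> (\<Sum>l<r. x l i * y l j) = (\<Sum>l<r. u l i * v l j)"
      and orth: "\<And>l l'. l < r \<Longrightarrow> l' < r \<Longrightarrow> l \<noteq> l' \<Longrightarrow> (\<Sum>j<q. v l j * v l' j) = 0"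
      by blast
    define c where "c l = (\<Sum>j<q. y r j * v l j) / (\<Sum>j<q. (v l j)\<^sup>2)" for l
    define z where "z j = y r j - (\<Sum>l<r. c l * v l j)" for j
    define u' where "u' l i = (if l < r then u l i + c l * x r i else x r i)" for l i
    define v' where "v' l = (if l < r then v l else z)" for l
    have zorth: "(\<Sum>j<q. z j * v l j) = 0" if "l < r" for l
    proof -
      have zero: "v l j = 0" if "(\<Sum>j<q. (v l j)\<^sup>2) = 0" "j < q" for j
        using that by (subst (asm) sum_nonneg_eq_0_iff) auto
      have "(\<Sum>j<q. z j * v l j) =
          (\<Sum>j<q. y r j * v l j) - (\<Sum>j<q. \<Sum>l'<r. c l' * (v l' j * v l j))"
        by (simp add: z_def sum_subtractf left_diff_distrib sum_distrib_right mult.assoc)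
      also have "(\<Sum>j<q. \<Sum>l'<r. c l' * (v l' j * v l j)) =
          (\<Sum>l'<r. c l' * (\<Sum>j<q. v l' j * v l j))"
        by (subst sum.swap) (simp add: sum_distrib_left)
      also have "\<dots> = (\<Sum>l'<r. if l' = l then c l * (\<Sum>j<q. (v l j)\<^sup>2) else 0)"
        using orth that by (intro sum.cong) (auto simp: power2_eq_square)
      also have "\<dots> = c l * (\<Sum>j<q. (v l j)\<^sup>2)"
        using that by simp
      also have "\<dots> = (\<Sum>j<q. y r j * v l j)"
        using zero by (cases "(\<Sum>j<q. (v l j)\<^sup>2) = 0") (auto simp: c_def)
      finally show ?thesis by simp
    qed
    have "(\<Sum>l<Suc r. x l i * y l j) = (\<Sum>l<Suc r. u' l i * v' l j)" if "j < q" for i j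
    proof -
      have "(\<Sum>l<Suc r. u' l i * v' l j) =
          (\<Sum>l<r. u l i * v l j) + x r i * ((\<Sum>l<r. c l * v l j) + z j)"
        by (simp add: u'_def v'_def distrib_right distrib_left sum.distrib sum_distrib_left algebra_simps)
      also have "(\<Sum>l<r. c l * v l j) + z j = y r j"
        by (simp add: z_def)
      finally show ?thesis using uv[OF that] by simp
    qed
    moreover have "(\<Sum>j<q. v' l j * v' l' j) = 0" if "l < Suc r" "l' < Suc r" "l \<noteq> l'" for l l'
      using that orth[of l l'] zorth[of l] zorth[of l']
      by (auto simp: v'_def less_Suc_eq mult.commute)
    ultimately show ?case by blast
  qed
  then obtain x' y' where "\<And>i j. j < q \<Longrightarrow> (\<Sum>l<r. x l i * y l j) = (\<Sum>l<r. x' l i * y' l j)"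
    "\<And>l l'. l < r \<Longrightarrow> l' < r \<Longrightarrow> l \<noteq> l' \<Longrightarrow> (\<Sum>j<q. y' l j * y' l' j) = 0"
    by blast
  then show thesis by (intro that[of x' y']) (simp_all add: xy)
qed

lemma inner_outer_rank_le:
  fixes N :: "nat \<Rightarrow> nat \<Rightarrow> real"
  assumes "outer_rank r D"
    and N: "\<And>y. (\<Sum>i<p. (\<Sum>j<q. N i j * y j)\<^sup>2) \<le> L * (\<Sum>j<q. (y j)\<^sup>2)"
    and "0 \<le> L"
  shows "\<bar>\<Sum>i<p. \<Sum>j<q. N i j * D i j\<bar> \<le> sqrt (r * L) * sqrt (\<Sum>i<p. \<Sum>j<q. (D i j)\<^sup>2)"
proof -
  obtain x y where D: "\<And>i j. j < q \<Longrightarrow> D i j = (\<Sum>l<r. x l i * y l j)"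
    and orth: "\<And>l l'. l < r \<Longrightarrow> l' < r \<Longrightarrow> l \<noteq> l' \<Longrightarrow> (\<Sum>j<q. y l j * y l' j) = 0"
    using outer_rank_orthogonal[OF assms(1)] by blast
  define X where "X l = (\<Sum>i<p. (x l i)\<^sup>2)" for l
  define Y where "Y l = (\<Sum>j<q. (y l j)\<^sup>2)" for l
  have X0: "0 \<le> X l" and Y0: "0 \<le> Y l" for l by (auto simp: X_def Y_def sum_nonneg)
  have normD: "(\<Sum>i<p. \<Sum>j<q. (D i j)\<^sup>2) = (\<Sum>l<r. X l * Y l)"
  proof -
    have "(\<Sum>j<q. (D i j)\<^sup>2) = (\<Sum>l<r. (x l i)\<^sup>2 * Y l)" for i
    proof -
      have "(\<Sum>j<q. (D i j)\<^sup>2) = (\<Sum>j<q. \<Sum>l<r. \<Sum>l'<r. (x l i * y l j) * (x l' i * y l' j))"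
        by (intro sum.cong refl) (simp add: D power2_eq_square sum_product)
      also have "\<dots> = (\<Sum>l<r. \<Sum>j<q. \<Sum>l'<r. (x l i * y l j) * (x l' i * y l' j))"
        by (rule sum.swap)
      also have "\<dots> = (\<Sum>l<r. \<Sum>l'<r. \<Sum>j<q. (x l i * y l j) * (x l' i * y l' j))"
        by (intro sum.cong refl sum.swap)
      also have "\<dots> = (\<Sum>l<r. \<Sum>l'<r. x l i * x l' i * (\<Sum>j<q. y l j * y l' j))"
        by (simp add: sum_distrib_left algebra_simps)
      also have "\<dots> = (\<Sum>l<r. \<Sum>l'<r. if l' = l then (x l i)\<^sup>2 * Y l else 0)"
        using orth by (intro sum.cong refl) (auto simp: Y_def power2_eq_square)
      also have "\<dots> = (\<Sum>l<r. (x l i)\<^sup>2 * Y l)" by simp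
      finally show ?thesis .
    qed
    then have "(\<Sum>i<p. \<Sum>j<q. (D i j)\<^sup>2) = (\<Sum>i<p. \<Sum>l<r. (x l i)\<^sup>2 * Y l)" by simp
    also have "\<dots> = (\<Sum>l<r. \<Sum>i<p. (x l i)\<^sup>2 * Y l)" by (rule sum.swap)
    finally show ?thesis by (simp add: X_def sum_distrib_right)
  qed
  have "(\<Sum>i<p. \<Sum>j<q. N i j * D i j) = (\<Sum>i<p. \<Sum>j<q. \<Sum>l<r. x l i * (N i j * y l j))"
    by (intro sum.cong refl) (simp add: D sum_distrib_left algebra_simps)
  also have "\<dots> = (\<Sum>i<p. \<Sum>l<r. \<Sum>j<q. x l i * (N i j * y l j))"
    by (intro sum.cong refl sum.swap)
  also have "\<dots> = (\<Sum>l<r. \<Sum>i<p. \<Sum>j<q. x l i * (N i j * y l j))"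
    by (rule sum.swap)
  also have "\<dots> = (\<Sum>l<r. \<Sum>i<p. x l i * (\<Sum>j<q. N i j * y l j))"
    by (simp add: sum_distrib_left)
  finally have "\<bar>\<Sum>i<p. \<Sum>j<q. N i j * D i j\<bar> \<le> (\<Sum>l<r. \<bar>\<Sum>i<p. x l i * (\<Sum>j<q. N i j * y l j)\<bar>)"
    by (simp add: sum_abs)
  also have "\<dots> \<le> (\<Sum>l<r. sqrt L * sqrt (X l * Y l))"
  proof (rule sum_mono)
    fix l
    have "(\<Sum>i<p. x l i * (\<Sum>j<q. N i j * y l j))\<^sup>2 \<le> X l * (\<Sum>i<p. (\<Sum>j<q. N i j * y l j)\<^sup>2)"
      unfolding X_def by (rule Cauchy_Schwarz_ineq_sum)
    also have "\<dots> \<le> X l * (L * Y l)"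
      using N X0 unfolding Y_def by (intro mult_left_mono) auto
    finally have "sqrt ((\<Sum>i<p. x l i * (\<Sum>j<q. N i j * y l j))\<^sup>2) \<le> sqrt (X l * (L * Y l))"
      by (rule real_sqrt_le_mono)
    then show "\<bar>\<Sum>i<p. x l i * (\<Sum>j<q. N i j * y l j)\<bar> \<le> sqrt L * sqrt (X l * Y l)"
      by (simp add: real_sqrt_mult algebra_simps)
  qed
  also have "\<dots> = sqrt L * (\<Sum>l<r. 1 * sqrt (X l * Y l))"
    by (simp add: sum_distrib_left)
  also have "\<dots> \<le> sqrt L * sqrt (r * (\<Sum>l<r. X l * Y l))"
  proof (intro mult_left_mono real_le_rsqrt)
    have "(\<Sum>l<r. 1 * sqrt (X l * Y l))\<^sup>2 \<le> (\<Sum>l<r. 1\<^sup>2) * (\<Sum>l<r. (sqrt (X l * Y l))\<^sup>2)"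
      by (rule Cauchy_Schwarz_ineq_sum)
    then show "(\<Sum>l<r. 1 * sqrt (X l * Y l))\<^sup>2 \<le> r * (\<Sum>l<r. X l * Y l)"
      using X0 Y0 by simp
  qed (use assms(3) in auto)
  finally show ?thesis
    by (simp add: normD real_sqrt_mult mult_ac)
qed

lemma norm_apply_le_gram:
  fixes N :: "nat \<Rightarrow> nat \<Rightarrow> real"
  assumes N: "\<And>i j. i < p \<Longrightarrow> j < q \<Longrightarrow> \<bar>N i j\<bar> \<le> 1"
    and F: "(\<Sum>j<q. \<Sum>j'\<in>{..<q} - {j}. (\<Sum>i<p. N i j * N i j')\<^sup>2) \<le> F"
  shows "(\<Sum>i<p. (\<Sum>j<q. N i j * y j)\<^sup>2) \<le> (p + sqrt F) * (\<Sum>j<q. (y j)\<^sup>2)"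
proof -
  define G where "G j j' = (\<Sum>i<p. N i j * N i j')" for j j'
  let ?Y = "\<Sum>j<q. (y j)\<^sup>2" and ?S = "SIGMA j:{..<q}. {..<q} - {j}"
  have Y0: "0 \<le> ?Y" by (simp add: sum_nonneg)
  have "(\<Sum>i<p. (\<Sum>j<q. N i j * y j)\<^sup>2) = (\<Sum>i<p. \<Sum>j<q. \<Sum>j'<q. N i j * y j * (N i j' * y j'))"
    by (simp add: power2_eq_square sum_product)
  also have "\<dots> = (\<Sum>j<q. \<Sum>i<p. \<Sum>j'<q. N i j * y j * (N i j' * y j'))"
    by (rule sum.swap)
  also have "\<dots> = (\<Sum>j<q. \<Sum>j'<q. \<Sum>i<p. N i j * y j * (N i j' * y j'))"
    by (intro sum.cong refl sum.swap)
  also have "\<dots> = (\<Sum>j<q. \<Sum>j'<q. y j * y j' * G j j')"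
    by (simp add: G_def sum_distrib_left algebra_simps)
  also have "\<dots> = (\<Sum>j<q. (y j)\<^sup>2 * G j j + (\<Sum>j'\<in>{..<q} - {j}. y j * y j' * G j j'))"
    by (intro sum.cong refl) (subst sum.remove[where x = j for j], auto simp: power2_eq_square)
  also have "\<dots> = (\<Sum>j<q. (y j)\<^sup>2 * G j j) + (\<Sum>(j, j')\<in>?S. (y j * y j') * G j j')"
    by (simp add: sum.distrib sum.Sigma)
  also have "(\<Sum>j<q. (y j)\<^sup>2 * G j j) \<le> (\<Sum>j<q. (y j)\<^sup>2 * p)"
  proof (intro sum_mono mult_left_mono)
    fix j assume "j \<in> {..<q}"
    then have "G j j \<le> (\<Sum>i<p. 1)"
      unfolding G_def using N[of _ j]
      by (intro sum_mono) (auto simp: power2_eq_square[symmetric] abs_square_le_1)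
    then show "G j j \<le> p" by simp
  qed auto
  also have "(\<Sum>(j, j')\<in>?S. (y j * y j') * G j j') \<le> ?Y * sqrt F"
  proof -
    have "(\<Sum>t\<in>?S. (G (fst t) (snd t))\<^sup>2) \<le> F"
      using F unfolding G_def by (simp add: sum.Sigma case_prod_beta)
    moreover have "(\<Sum>t\<in>?S. (y (fst t) * y (snd t))\<^sup>2) \<le> ?Y\<^sup>2"
    proof -
      have "(\<Sum>t\<in>?S. (y (fst t) * y (snd t))\<^sup>2) \<le>
          (\<Sum>t\<in>{..<q} \<times> {..<q}. (y (fst t) * y (snd t))\<^sup>2)"
        by (intro sum_mono2) auto
      also have "\<dots> = ?Y\<^sup>2"
        by (simp add: power2_eq_square sum_product sum.cartesian_product case_prod_beta mult_ac)
      finally show ?thesis .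
    qed
    ultimately have "(\<Sum>t\<in>?S. (y (fst t) * y (snd t))\<^sup>2) * (\<Sum>t\<in>?S. (G (fst t) (snd t))\<^sup>2)
        \<le> ?Y\<^sup>2 * F"
      by (intro mult_mono) (auto simp: sum_nonneg)
    then have "(\<Sum>t\<in>?S. (y (fst t) * y (snd t)) * G (fst t) (snd t))\<^sup>2 \<le> ?Y\<^sup>2 * F"
      by (rule order_trans[OF Cauchy_Schwarz_ineq_sum])
    then have "(\<Sum>t\<in>?S. (y (fst t) * y (snd t)) * G (fst t) (snd t)) \<le> sqrt (?Y\<^sup>2 * F)"
      by (rule real_le_rsqrt)
    then show ?thesis using Y0 by (simp add: real_sqrt_mult case_prod_beta)
  qed
  finally show ?thesis by (simp add: sum_distrib_left algebra_simps)
qed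

section \<open>Queries about hidden signs\<close>

lemma sum_PiE_remove:
  assumes "finite U" "c \<in> U"
  shows "(\<Sum>z\<in>PiE U (\<lambda>_. S). g z) = (\<Sum>v\<in>S. \<Sum>z\<in>PiE (U - {c}) (\<lambda>_. S). g (z(c := v)))"
proof -
  let ?F = "\<lambda>(y, f). f(c := y)"
  have "PiE U (\<lambda>_. S) = ?F ` (S \<times> PiE (U - {c}) (\<lambda>_. S))"
    using PiE_insert_eq[of c "U - {c}" "\<lambda>_. S"] assms(2) by (simp add: insert_absorb)
  moreover have "inj_on ?F (S \<times> PiE (U - {c}) (\<lambda>_. S))"
    using inj_combinator[of c "U - {c}" "\<lambda>_. S"] by simp
  ultimately have "(\<Sum>z\<in>PiE U (\<lambda>_. S). g z) = (\<Sum>(v, z)\<in>S \<times> PiE (U - {c}) (\<lambda>_. S). g (z(c := v)))"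
    by (simp only: sum.reindex) (simp add: case_prod_beta)
  then show ?thesis by (simp add: sum.cartesian_product)
qed

abbreviation signs :: "real set" where "signs \<equiv> {-1, 1}"

definition override :: "'c set \<Rightarrow> ('c \<Rightarrow> real) \<Rightarrow> ('c \<Rightarrow> real) \<Rightarrow> 'c \<Rightarrow> real" where
  "override U \<rho> z = (\<lambda>c. if c \<in> U then z c else \<rho> c)"

lemma override_upd: "c \<in> U \<Longrightarrow> override U \<rho> (z(c := v)) = override (U - {c}) (\<rho>(c := v)) z"
  by (auto simp: override_def)

lemma override_signs: "z \<in> PiE U (\<lambda>_. signs) \<Longrightarrow> range (override U (\<lambda>_. 1) z) \<subseteq> signs"
  by (auto simp: override_def PiE_iff)

locale sign_model =
  fixes P :: "'e set" and C :: "'c set" and par :: "'c \<Rightarrow> 'e" and \<eta> :: real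
  assumes finite_P: "finite P" and finite_C: "finite C"
    and par: "\<And>c. c \<in> C \<Longrightarrow> par c \<in> P"
    and eta: "0 < \<eta>" "\<eta> < 1"
begin

text \<open>The joint law of hidden signs \<open>s\<close>, independent with means \<open>\<mu>\<close>, and of the observable signs
  \<open>z\<close> on the cells \<open>U\<close> not yet read, which given \<open>s\<close> are independent with means \<open>\<eta> s\<close>.\<close>

definition weight :: "('e \<Rightarrow> real) \<Rightarrow> 'c set \<Rightarrow> ('e \<Rightarrow> real) \<Rightarrow> ('c \<Rightarrow> real) \<Rightarrow> real" where
  "weight \<mu> U s z = (\<Prod>e\<in>P. (1 + \<mu> e * s e) / 2) * (\<Prod>c\<in>U. (1 + \<eta> * z c * s (par c)) / 2)"

definition mean :: "('e \<Rightarrow> real) \<Rightarrow> 'c set \<Rightarrow> (('e \<Rightarrow> real) \<Rightarrow> ('c \<Rightarrow> real) \<Rightarrow> real) \<Rightarrow> real" where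
  "mean \<mu> U g = (\<Sum>s\<in>PiE P (\<lambda>_. signs). \<Sum>z\<in>PiE U (\<lambda>_. signs). weight \<mu> U s z * g s z)"

lemma mean_add: "mean \<mu> U (\<lambda>s z. f s z + g s z) = mean \<mu> U f + mean \<mu> U g"
  by (simp add: mean_def distrib_left sum.distrib)

lemma mean_diff: "mean \<mu> U (\<lambda>s z. f s z - g s z) = mean \<mu> U f - mean \<mu> U g"
  by (simp add: mean_def right_diff_distrib sum_subtractf)

lemma mean_cmult: "mean \<mu> U (\<lambda>s z. a * f s z) = a * mean \<mu> U f"
  by (simp add: mean_def sum_distrib_left mult_ac)

lemma mean_sum: "mean \<mu> U (\<lambda>s z. \<Sum>i\<in>I. f i s z) = (\<Sum>i\<in>I. mean \<mu> U (f i))"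
  by (induction I rule: infinite_finite_induct) (simp_all add: mean_add, simp_all add: mean_def)

lemma weight_nonneg:
  assumes "\<And>e. e \<in> P \<Longrightarrow> \<bar>\<mu> e\<bar> \<le> 1" "U \<subseteq> C" "s \<in> PiE P (\<lambda>_. signs)" "z \<in> PiE U (\<lambda>_. signs)"
  shows "0 \<le> weight \<mu> U s z"
proof -
  have "0 \<le> 1 + \<mu> e * s e" if "e \<in> P" for e
    using assms(1)[OF that] PiE_mem[OF assms(3) that] by (auto simp: abs_le_iff)
  moreover have "0 \<le> 1 + \<eta> * z c * s (par c)" if "c \<in> U" for c
  proof -
    have "s (par c) \<in> signs" "z c \<in> signs"
      using PiE_mem[OF assms(3) par] PiE_mem[OF assms(4)] that assms(2) by auto
    then show ?thesis using eta by auto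
  qed
  ultimately show ?thesis
    unfolding weight_def by (intro mult_nonneg_nonneg prod_nonneg) auto
qed

lemma mean_mono:
  assumes "\<And>e. e \<in> P \<Longrightarrow> \<bar>\<mu> e\<bar> \<le> 1" "U \<subseteq> C"
    and "\<And>s z. s \<in> PiE P (\<lambda>_. signs) \<Longrightarrow> z \<in> PiE U (\<lambda>_. signs) \<Longrightarrow> f s z \<le> g s z"
  shows "mean \<mu> U f \<le> mean \<mu> U g"
  unfolding mean_def by (intro sum_mono mult_left_mono assms(3) weight_nonneg[OF assms(1,2)]) auto

lemma mean_cong:
  assumes "\<And>s z. s \<in> PiE P (\<lambda>_. signs) \<Longrightarrow> z \<in> PiE U (\<lambda>_. signs) \<Longrightarrow> f s z = g s z"
  shows "mean \<mu> U f = mean \<mu> U g"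
  unfolding mean_def by (intro sum.cong refl) (simp add: assms)

lemma mean_hidden_prod:
  assumes "finite U"
  shows "mean \<mu> U (\<lambda>s z. \<Prod>e\<in>P. f e (s e)) =
    (\<Prod>e\<in>P. ((1 + \<mu> e) * f e 1 + (1 - \<mu> e) * f e (-1)) / 2)"
proof -
  have "(\<Sum>z\<in>PiE U (\<lambda>_. signs). weight \<mu> U s z * (\<Prod>e\<in>P. f e (s e))) =
      (\<Prod>e\<in>P. (1 + \<mu> e * s e) / 2 * f e (s e))" for s
  proof -
    have "(\<Sum>z\<in>PiE U (\<lambda>_. signs). \<Prod>c\<in>U. (1 + \<eta> * z c * s (par c)) / 2) =
        (\<Prod>c\<in>U. \<Sum>v\<in>signs. (1 + \<eta> * v * s (par c)) / 2)"
      using assms by (subst prod_sum_PiE) auto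
    also have "\<dots> = 1" by (intro prod.neutral) (auto simp: add_divide_distrib)
    finally have one: "(\<Sum>z\<in>PiE U (\<lambda>_. signs). \<Prod>c\<in>U. (1 + \<eta> * z c * s (par c)) / 2) = 1" .
    have "(\<Sum>z\<in>PiE U (\<lambda>_. signs). weight \<mu> U s z * (\<Prod>e\<in>P. f e (s e))) =
        (\<Prod>e\<in>P. (1 + \<mu> e * s e) / 2) * (\<Sum>z\<in>PiE U (\<lambda>_. signs). \<Prod>c\<in>U. (1 + \<eta> * z c * s (par c)) / 2) *
        (\<Prod>e\<in>P. f e (s e))"
      unfolding weight_def by (simp only: sum_distrib_left sum_distrib_right)
    then show ?thesis by (simp only: one mult_1_right prod.distrib)
  qed
  then have "mean \<mu> U (\<lambda>s z. \<Prod>e\<in>P. f e (s e)) =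
      (\<Sum>s\<in>PiE P (\<lambda>_. signs). \<Prod>e\<in>P. (1 + \<mu> e * s e) / 2 * f e (s e))"
    by (simp add: mean_def)
  also have "\<dots> = (\<Prod>e\<in>P. \<Sum>v\<in>signs. (1 + \<mu> e * v) / 2 * f e v)"
    using finite_P by (subst prod_sum_PiE) auto
  also have "\<dots> = (\<Prod>e\<in>P. ((1 + \<mu> e) * f e 1 + (1 - \<mu> e) * f e (-1)) / 2)"
    by (intro prod.cong) (auto simp: field_simps)
  finally show ?thesis .
qed

lemma mean_const: "finite U \<Longrightarrow> mean \<mu> U (\<lambda>s z. a) = a"
  using mean_hidden_prod[of U \<mu> "\<lambda>_ _. 1"] mean_cmult[of \<mu> U a "\<lambda>_ _. 1"] by simp

lemma mean_hidden:
  assumes "finite U" "e \<in> P"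
  shows "mean \<mu> U (\<lambda>s z. s e) = \<mu> e"
proof -
  have "(\<Prod>e'\<in>P. if e' = e then s e' else 1) = s e" for s :: "'e \<Rightarrow> real"
    using assms(2) finite_P by (simp add: prod.delta)
  then have "mean \<mu> U (\<lambda>s z. s e) = mean \<mu> U (\<lambda>s z. \<Prod>e'\<in>P. if e' = e then s e' else 1)"
    by simp
  also have "\<dots> = (\<Prod>e'\<in>P. if e' = e then \<mu> e' else 1)"
    unfolding mean_hidden_prod[OF assms(1), of \<mu> "\<lambda>e' v. if e' = e then v else 1"]
    by (intro prod.cong) auto
  finally show ?thesis using assms(2) finite_P by (simp add: prod.delta)
qed

text \<open>Reading cell \<open>c\<close> is a Bayesian update: the law splits over the value read, and the
  hidden signs stay independent, with only the mean of \<open>s (par c)\<close> changed.\<close>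

definition update :: "('e \<Rightarrow> real) \<Rightarrow> 'c \<Rightarrow> real \<Rightarrow> 'e \<Rightarrow> real" where
  "update \<mu> c v = \<mu>(par c := (\<mu> (par c) + \<eta> * v) / (1 + \<eta> * \<mu> (par c) * v))"

lemma update_denominator_pos:
  assumes "\<bar>m\<bar> \<le> 1" "v \<in> signs"
  shows "0 < 1 + \<eta> * m * v"
proof -
  have "\<bar>\<eta> * m * v\<bar> = \<eta> * \<bar>m\<bar>"
    using assms eta by (auto simp: abs_mult)
  also have "\<dots> \<le> \<eta>" using assms eta by (simp add: mult_left_le)
  finally show ?thesis using eta by linarith
qed

lemma abs_update_le_1:
  assumes "\<bar>\<mu> e\<bar> \<le> 1" "\<bar>\<mu> (par c)\<bar> \<le> 1" "v \<in> signs"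
  shows "\<bar>update \<mu> c v e\<bar> \<le> 1"
proof (cases "e = par c")
  case True
  let ?m = "\<mu> (par c)"
  have "0 \<le> (1 - ?m) * (1 - \<eta> * v)" "0 \<le> (1 + ?m) * (1 + \<eta> * v)"
    using assms eta by (auto intro!: mult_nonneg_nonneg)
  then have "?m + \<eta> * v \<le> 1 + \<eta> * ?m * v" "- (1 + \<eta> * ?m * v) \<le> ?m + \<eta> * v"
    by (simp_all add: algebra_simps)
  then show ?thesis
    using True update_denominator_pos[OF assms(2,3)] by (simp add: update_def abs_le_iff field_simps)
qed (use assms in \<open>simp add: update_def\<close>)

lemma sum_update_squares_le:
  assumes "c \<in> C" "\<And>e. e \<in> P \<Longrightarrow> \<bar>\<mu> e\<bar> \<le> 1"
  shows "(\<Sum>v\<in>signs. (1 + \<eta> * \<mu> (par c) * v) / 2 * (\<Sum>e\<in>P. (update \<mu> c v e)\<^sup>2)) \<le> (\<Sum>e\<in>P. (\<mu> e)\<^sup>2) + \<eta>\<^sup>2"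
proof -
  define m where "m = \<mu> (par c)"
  have m: "\<bar>m\<bar> \<le> 1" using assms par by (simp add: m_def)
  define R where "R = (\<Sum>e\<in>P - {par c}. (\<mu> e)\<^sup>2)"
  define a b where "a = 1 + \<eta> * m" and "b = 1 - \<eta> * m"
  have pos: "0 < a" "0 < b"
    using update_denominator_pos[OF m, of 1] update_denominator_pos[OF m, of "-1"]
    by (simp_all add: a_def b_def)
  have sumP: "(\<Sum>e\<in>P. (update \<mu> c v e)\<^sup>2) = ((m + \<eta> * v) / (1 + \<eta> * m * v))\<^sup>2 + R" for v
    unfolding R_def using finite_P par[OF assms(1)]
    by (subst sum.remove[of _ "par c"]) (auto simp: update_def m_def)
  have sumP': "(\<Sum>e\<in>P. (\<mu> e)\<^sup>2) = m\<^sup>2 + R"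
    unfolding R_def m_def using finite_P par[OF assms(1)] by (rule sum.remove)
  have "\<eta>\<^sup>2 \<le> 1" "m\<^sup>2 \<le> 1"
    using eta m by (auto simp: power_le_one abs_square_le_1)
  then have "0 \<le> 2 * (\<eta>\<^sup>2 * m\<^sup>2) * (2 - m\<^sup>2 - \<eta>\<^sup>2)" by (intro mult_nonneg_nonneg) auto
  also have "\<dots> = 2 * (m\<^sup>2 + \<eta>\<^sup>2) * (a * b) - ((m + \<eta>)\<^sup>2 * b + (m - \<eta>)\<^sup>2 * a)"
    by (simp add: a_def b_def power2_eq_square algebra_simps)
  finally have "(m + \<eta>)\<^sup>2 / a + (m - \<eta>)\<^sup>2 / b \<le> 2 * (m\<^sup>2 + \<eta>\<^sup>2)"
    using pos by (simp add: field_simps)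
  moreover have "(\<Sum>v\<in>signs. (1 + \<eta> * m * v) / 2 * (\<Sum>e\<in>P. (update \<mu> c v e)\<^sup>2)) =
      a / 2 * (((m + \<eta>) / a)\<^sup>2 + R) + b / 2 * (((m - \<eta>) / b)\<^sup>2 + R)"
    by (simp add: sumP a_def b_def)
  moreover have "\<dots> = ((m + \<eta>)\<^sup>2 / a + (m - \<eta>)\<^sup>2 / b) / 2 + (a + b) / 2 * R"
    using pos by (simp add: field_simps power2_eq_square)
  moreover have "a + b = 2" by (simp add: a_def b_def)
  ultimately show ?thesis unfolding m_def[symmetric] sumP' by simp
qed

lemma mean_split:
  assumes "c \<in> U" "U \<subseteq> C" "\<bar>\<mu> (par c)\<bar> \<le> 1"
  shows "mean \<mu> U g =
    (\<Sum>v\<in>signs. (1 + \<eta> * \<mu> (par c) * v) / 2 * mean (update \<mu> c v) (U - {c}) (\<lambda>s z. g s (z(c := v))))"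
proof -
  have fin: "finite U" using assms(2) finite_C finite_subset by blast
  have cP: "par c \<in> P" using assms par by blast
  have w: "weight \<mu> U s (z(c := v)) = (1 + \<eta> * \<mu> (par c) * v) / 2 * weight (update \<mu> c v) (U - {c}) s z"
    if "s \<in> PiE P (\<lambda>_. signs)" "v \<in> signs" for s z v
  proof -
    let ?m = "\<mu> (par c)" and ?t = "s (par c)"
    have "?t \<in> signs" using that(1) cP by (rule PiE_mem)
    then have t: "?t * ?t = 1" "v * v = 1" using that(2) by auto
    have pos: "0 < 1 + \<eta> * ?m * v" by (rule update_denominator_pos[OF assms(3) that(2)])
    have U: "(\<Prod>d\<in>U. (1 + \<eta> * (z(c := v)) d * s (par d)) / 2) =
        (1 + \<eta> * v * ?t) / 2 * (\<Prod>d\<in>U - {c}. (1 + \<eta> * z d * s (par d)) / 2)"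
      by (subst prod.remove[OF fin assms(1)]) auto
    have P1: "(\<Prod>e\<in>P. (1 + \<mu> e * s e) / 2) =
        (1 + ?m * ?t) / 2 * (\<Prod>e\<in>P - {par c}. (1 + \<mu> e * s e) / 2)"
      by (rule prod.remove[OF finite_P cP])
    have P2: "(\<Prod>e\<in>P. (1 + update \<mu> c v e * s e) / 2) =
        (1 + (?m + \<eta> * v) / (1 + \<eta> * ?m * v) * ?t) / 2 * (\<Prod>e\<in>P - {par c}. (1 + \<mu> e * s e) / 2)"
      by (subst prod.remove[OF finite_P cP]) (auto simp: update_def)
    have regroup: "(a / 2 * X) * (b / 2 * Y) = r / 2 * ((d / 2 * X) * Y)" if "a * b = r * d"
      for a b r d X Y :: real
    proof -
      have "(a / 2 * X) * (b / 2 * Y) = a * b * (X * Y / 4)" by simp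
      also have "\<dots> = r / 2 * ((d / 2 * X) * Y)" unfolding that by simp
      finally show ?thesis .
    qed
    have "(1 + ?m * ?t) * (1 + \<eta> * v * ?t) = 1 + \<eta> * ?m * v * (?t * ?t) + (?m + \<eta> * v) * ?t"
      by (simp add: algebra_simps)
    also have "\<dots> = (1 + \<eta> * ?m * v) * (1 + (?m + \<eta> * v) / (1 + \<eta> * ?m * v) * ?t)"
      using pos t by (simp add: distrib_left)
    finally show ?thesis unfolding weight_def U P1 P2 by (rule regroup)
  qed
  have "mean \<mu> U g = (\<Sum>s\<in>PiE P (\<lambda>_. signs). \<Sum>v\<in>signs. \<Sum>z\<in>PiE (U - {c}) (\<lambda>_. signs).
      weight \<mu> U s (z(c := v)) * g s (z(c := v)))"
    unfolding mean_def by (intro sum.cong refl sum_PiE_remove[OF fin assms(1)])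
  also have "\<dots> = (\<Sum>v\<in>signs. \<Sum>s\<in>PiE P (\<lambda>_. signs). \<Sum>z\<in>PiE (U - {c}) (\<lambda>_. signs).
      weight \<mu> U s (z(c := v)) * g s (z(c := v)))"
    by (rule sum.swap)
  also have "\<dots> = (\<Sum>v\<in>signs. (1 + \<eta> * \<mu> (par c) * v) / 2 *
      mean (update \<mu> c v) (U - {c}) (\<lambda>s z. g s (z(c := v))))"
    unfolding mean_def sum_distrib_left
    by (intro sum.cong refl) (simp add: w mult.assoc)
  finally show ?thesis .
qed

text \<open>The expected sum of the squares of the posterior means grows by at most \<open>\<eta>\<^sup>2\<close> per cell read,
  and an output depending on the cells read correlates with a hidden sign at most as much as its
  posterior mean does; the latter is linearised by \<open>2 \<mu> \<le> \<lambda> \<mu>\<^sup>2 + 1 / \<lambda>\<close>.\<close>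

lemma correlation_le_reads:
  fixes A :: "('c \<Rightarrow> real) \<Rightarrow> real mat"
  assumes A: "\<And>z i j. i < n \<Longrightarrow> j < m \<Longrightarrow> A z $$ (i, j) = h i j (z (cell i j))"
    and \<sigma>: "\<And>e out. \<bar>\<sigma> e out\<bar> \<le> 1" and lam: "0 < lam"
    and "queries_within n m T" "U \<subseteq> C" "\<And>e. e \<in> P \<Longrightarrow> \<bar>\<mu> e\<bar> \<le> 1"
  shows "mean \<mu> U (\<lambda>s z. \<Sum>e\<in>P. s e * \<sigma> e (run (A (override U \<rho> z)) T)) \<le>
    (lam * (\<Sum>e\<in>P. (\<mu> e)\<^sup>2) + lam * \<eta>\<^sup>2 *
       mean \<mu> U (\<lambda>s z. card (U \<inter> (\<lambda>(i, j). cell i j) ` entries_read (A (override U \<rho> z)) T)) + card P / lam) / 2"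
  using assms(4-6)
proof (induction T arbitrary: \<mu> U \<rho>)
  case (Output V W)
  then have fin: "finite U" using finite_C finite_subset by blast
  have "mean \<mu> U (\<lambda>s z. \<Sum>e\<in>P. s e * \<sigma> e (V, W)) = (\<Sum>e\<in>P. \<sigma> e (V, W) * mean \<mu> U (\<lambda>s z. s e))"
    by (simp add: mean_sum mean_cmult[symmetric] mult.commute)
  also have "\<dots> = (\<Sum>e\<in>P. \<sigma> e (V, W) * \<mu> e)"
    using fin by (simp add: mean_hidden)
  also have "\<dots> \<le> (\<Sum>e\<in>P. (lam * (\<mu> e)\<^sup>2 + 1 / lam) / 2)"
  proof (rule sum_mono)
    fix e assume "e \<in> P"
    let ?t = "\<sigma> e (V, W)"
    have "0 \<le> (lam * \<mu> e - ?t)\<^sup>2" by simp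
    also have "\<dots> \<le> lam\<^sup>2 * (\<mu> e)\<^sup>2 - 2 * lam * (?t * \<mu> e) + 1"
      using \<sigma>[of e "(V, W)"] by (simp add: power2_diff power_mult_distrib abs_square_le_1 mult_ac)
    finally have "2 * lam * (?t * \<mu> e) \<le> lam * (lam * (\<mu> e)\<^sup>2 + 1 / lam)"
      using lam by (simp add: power2_eq_square algebra_simps)
    then show "?t * \<mu> e \<le> (lam * (\<mu> e)\<^sup>2 + 1 / lam) / 2"
      using lam by (simp add: mult.assoc mult.left_commute[of 2 lam])
  qed
  also have "\<dots> = (lam * (\<Sum>e\<in>P. (\<mu> e)\<^sup>2) + card P / lam) / 2"
    by (simp add: sum_divide_distrib[symmetric] sum.distrib sum_distrib_left)
  finally show ?case using fin by (simp add: mean_const)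
next
  case (Query i j f)
  let ?c = "cell i j" and ?img = "\<lambda>X. (\<lambda>(i, j). cell i j) ` X"
  have ij: "i < n" "j < m" and qw: "queries_within n m (f a)" for a using Query.prems by auto
  have fin: "finite U" using Query.prems finite_C finite_subset by blast
  show ?case
  proof (cases "?c \<in> U")
    case False
    have val: "A (override U \<rho> z) $$ (i, j) = h i j (\<rho> ?c)" for z
      using A[OF ij] False by (simp add: override_def)
    show ?thesis
      using Query.IH[OF rangeI qw[of "h i j (\<rho> ?c)"] Query.prems(2,3), where \<rho> = \<rho>] False by (simp add: val)
  next
    case True
    then have cC: "?c \<in> C" using Query.prems by blast
    have \<mu>c: "\<bar>\<mu> (par ?c)\<bar> \<le> 1" using Query.prems par[OF cC] by blast
    note split = mean_split[where \<mu> = \<mu> and c = ?c, OF True Query.prems(2) \<mu>c]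
    let ?p = "\<lambda>v. (1 + \<eta> * \<mu> (par ?c) * v) / 2" and ?\<mu> = "update \<mu> ?c" and ?U = "U - {?c}"
    let ?z = "\<lambda>v z. A (override ?U (\<rho>(?c := v)) z)"
    let ?R = "\<lambda>v. mean (?\<mu> v) ?U (\<lambda>s z. card (?U \<inter> ?img (entries_read (?z v z) (f (h i j v)))))"
    have val: "?z v z $$ (i, j) = h i j v" for v z
      using A[OF ij] True by (simp add: override_def)
    have p: "0 \<le> ?p v" if "v \<in> signs" for v
      using update_denominator_pos[OF \<mu>c that] by simp
    have psum: "(\<Sum>v\<in>signs. ?p v) = 1" by (simp add: field_simps)
    have reads: "mean \<mu> U (\<lambda>s z. card (U \<inter> ?img (entries_read (A (override U \<rho> z)) (Query i j f)))) =
        1 + (\<Sum>v\<in>signs. ?p v * ?R v)"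
    proof -
      have "card (U \<inter> insert ?c X) = 1 + card (?U \<inter> X)" for X
      proof -
        have "U \<inter> insert ?c X = insert ?c (?U \<inter> X)" using True by auto
        then show ?thesis using fin by simp
      qed
      then have "mean \<mu> U (\<lambda>s z. card (U \<inter> ?img (entries_read (A (override U \<rho> z)) (Query i j f)))) =
          (\<Sum>v\<in>signs. ?p v * (1 + ?R v))"
        unfolding split
        by (intro sum.cong refl arg_cong2[where f = "(*)"])
          (simp add: val override_upd[OF True] mean_add mean_const fin)
      also have "\<dots> = (\<Sum>v\<in>signs. ?p v) + (\<Sum>v\<in>signs. ?p v * ?R v)"
        by (simp only: distrib_left sum.distrib mult_1_right)
      finally show ?thesis by (simp only: psum)
    qed
    have "mean \<mu> U (\<lambda>s z. \<Sum>e\<in>P. s e * \<sigma> e (run (A (override U \<rho> z)) (Query i j f))) =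
        (\<Sum>v\<in>signs. ?p v * mean (?\<mu> v) ?U (\<lambda>s z. \<Sum>e\<in>P. s e * \<sigma> e (run (?z v z) (f (h i j v)))))"
      unfolding split
      by (intro sum.cong refl) (simp add: val override_upd[OF True])
    also have "\<dots> \<le> (\<Sum>v\<in>signs. ?p v *
        ((lam * (\<Sum>e\<in>P. (?\<mu> v e)\<^sup>2) + lam * \<eta>\<^sup>2 * ?R v + card P / lam) / 2))"
    proof (intro sum_mono mult_left_mono p)
      fix v assume v: "v \<in> signs"
      show "mean (?\<mu> v) ?U (\<lambda>s z. \<Sum>e\<in>P. s e * \<sigma> e (run (?z v z) (f (h i j v)))) \<le>
          (lam * (\<Sum>e\<in>P. (?\<mu> v e)\<^sup>2) + lam * \<eta>\<^sup>2 * ?R v + card P / lam) / 2"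
        using Query.prems(2,3) abs_update_le_1[where \<mu> = \<mu> and c = ?c, OF _ \<mu>c v]
        by (intro Query.IH[OF rangeI qw]) auto
    qed auto
    also have "\<dots> = (\<Sum>v\<in>signs. lam / 2 * (?p v * (\<Sum>e\<in>P. (?\<mu> v e)\<^sup>2)) +
        lam * \<eta>\<^sup>2 / 2 * (?p v * ?R v) + card P / lam / 2 * ?p v)"
      by (intro sum.cong refl) (simp only: add_divide_distrib distrib_left times_divide_eq_right
        times_divide_eq_left mult_ac)
    also have "\<dots> = lam / 2 * (\<Sum>v\<in>signs. ?p v * (\<Sum>e\<in>P. (?\<mu> v e)\<^sup>2)) +
        lam * \<eta>\<^sup>2 / 2 * (\<Sum>v\<in>signs. ?p v * ?R v) + card P / lam / 2"
      by (simp only: sum.distrib sum_distrib_left[symmetric] psum mult_1_right)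
    also have "\<dots> \<le> lam / 2 * ((\<Sum>e\<in>P. (\<mu> e)\<^sup>2) + \<eta>\<^sup>2) +
        lam * \<eta>\<^sup>2 / 2 * (\<Sum>v\<in>signs. ?p v * ?R v) + card P / lam / 2"
      using sum_update_squares_le[OF cC Query.prems(3)] lam
      by (intro add_right_mono mult_left_mono) auto
    also have "\<dots> = (lam * (\<Sum>e\<in>P. (\<mu> e)\<^sup>2) + lam * \<eta>\<^sup>2 * (1 + (\<Sum>v\<in>signs. ?p v * ?R v)) + card P / lam) / 2"
      by (simp only: add_divide_distrib distrib_left) (simp add: mult_ac)
    finally show ?thesis unfolding reads .
  qed
qed

end

lemma entries_read_subset: "queries_within n m T \<Longrightarrow> entries_read A T \<subseteq> {..<n} \<times> {..<m}"
  by (induction T) auto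

lemma num_reads_le: "queries_within n m T \<Longrightarrow> num_reads A T \<le> n * m"
  using card_mono[OF _ entries_read_subset[of n m T A]] by (simp add: num_reads_def)

context sign_model
begin

lemma integral_mean:
  assumes "\<And>s z. z \<in> PiE U (\<lambda>_. signs) \<Longrightarrow> integrable M (F s z)"
  shows "integrable M (\<lambda>T. mean \<mu> U (\<lambda>s z. F s z T))"
    and "(LINT T|M. mean \<mu> U (\<lambda>s z. F s z T)) = mean \<mu> U (\<lambda>s z. LINT T|M. F s z T)"
  using assms unfolding mean_def by (simp_all add: Bochner_Integration.integral_sum)

lemma query_lower_bound_of_decoding:
  fixes A :: "('c \<Rightarrow> real) \<Rightarrow> real mat"
  assumes A: "\<And>z i j. i < n \<Longrightarrow> j < m \<Longrightarrow> A z $$ (i, j) = h i j (z (cell i j))"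
    and \<sigma>: "\<And>e out. \<bar>\<sigma> e out\<bar> \<le> 1"
    and A_in: "\<And>z. range z \<subseteq> signs \<Longrightarrow> A z \<in> \<A>"
    and decode: "\<And>s z V W. s \<in> PiE P (\<lambda>_. signs) \<Longrightarrow> range z \<subseteq> signs \<Longrightarrow> typical s z \<Longrightarrow>
      good_low_rank_approx k \<epsilon> (A z) V W \<Longrightarrow> 11 / 12 * card P \<le> (\<Sum>e\<in>P. s e * \<sigma> e (V, W))"
    and typical: "mean (\<lambda>_. 0) C (\<lambda>s z. of_bool (\<not> typical s (override C (\<lambda>_. 1) z))) \<le> 1 / 10"
  shows "query_lower_bound n m k \<epsilon> \<A> (card P / (100 * \<eta>\<^sup>2))"
  unfolding query_lower_bound_def
proof (intro allI impI)
  fix M assume M: "randomized_alg n m \<A> M \<and> solves_low_rank_approx k \<epsilon> \<A> M"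
  then interpret prob_space M by (simp add: randomized_alg_def)
  let ?q = "card P / (100 * \<eta>\<^sup>2)"
  have qw: "queries_within n m T" if "T \<in> space M" for T
    using M that by (simp add: randomized_alg_def)
  define X where "X z = A (override C (\<lambda>_. 1) z)" for z
  define S where "S z = {T \<in> space M. case run (X z) T of (V, W) \<Rightarrow> good_low_rank_approx k \<epsilon> (X z) V W}" for z
  let ?ok = "\<lambda>s z. of_bool (typical s (override C (\<lambda>_. 1) z)) :: real"
  have X_in: "X z \<in> \<A>" if "z \<in> PiE C (\<lambda>_. signs)" for z
    unfolding X_def by (intro A_in override_signs that)
  have S: "S z \<in> sets M" "2 / 3 \<le> prob (S z)" if "z \<in> PiE C (\<lambda>_. signs)" for z
    using M X_in[OF that] unfolding solves_low_rank_approx_def S_def by auto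
  have reads_int: "integrable M (\<lambda>T. real (num_reads (X z) T))" if "z \<in> PiE C (\<lambda>_. signs)" for z
  proof (rule integrable_const_bound[where B = "real (n * m)"])
    show "AE T in M. norm (real (num_reads (X z) T)) \<le> real (n * m)"
      using num_reads_le[OF qw] by (intro AE_I2) (simp del: of_nat_mult)
    have "num_reads (X z) \<in> measurable M (count_space UNIV)"
      using M X_in[OF that] by (simp add: randomized_alg_def)
    then show "(\<lambda>T. real (num_reads (X z) T)) \<in> borel_measurable M" by measurable
  qed
  show "\<exists>B\<in>\<A>. ?q \<le> expected_reads M B"
  proof (rule ccontr)
    assume "\<not> ?thesis"
    then have few: "expected_reads M B < ?q" if "B \<in> \<A>" for B using that by force
    have "0 \<le> expected_reads M (A (\<lambda>_. 1))"
      unfolding expected_reads_def by (intro integral_nonneg_AE AE_I2) simp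
    also have "\<dots> < ?q" by (intro few A_in) auto
    finally have cardP: "0 < real (card P)" using eta by (simp add: zero_less_divide_iff)
    have zero: "\<bar>(\<lambda>_. 0) e\<bar> \<le> (1::real)" for e :: 'e by simp
    have pointwise: "card P * (23 / 12 * mean (\<lambda>_. 0) C (\<lambda>s z. ?ok s z * indicator (S z) T) - 1)
        \<le> (10 * \<eta>\<^sup>2 * mean (\<lambda>_. 0) C (\<lambda>s z. num_reads (X z) T) + card P / 10) / 2"
      if T: "T \<in> space M" for T
    proof -
      have "card P * (23 / 12 * mean (\<lambda>_. 0) C (\<lambda>s z. ?ok s z * indicator (S z) T) - 1) =
          mean (\<lambda>_. 0) C (\<lambda>s z. card P * (23 / 12 * (?ok s z * indicator (S z) T) - 1))"
        by (simp only: mean_cmult mean_diff mean_const[OF finite_C])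
      also have "\<dots> \<le> mean (\<lambda>_. 0) C (\<lambda>s z. \<Sum>e\<in>P. s e * \<sigma> e (run (X z) T))"
      proof (rule mean_mono[OF zero order_refl])
        fix s z assume s: "s \<in> PiE P (\<lambda>_. signs)" and z: "z \<in> PiE C (\<lambda>_. signs)"
        show "card P * (23 / 12 * (?ok s z * indicator (S z) T) - 1) \<le> (\<Sum>e\<in>P. s e * \<sigma> e (run (X z) T))"
        proof (cases "typical s (override C (\<lambda>_. 1) z) \<and> T \<in> S z")
          case True
          obtain V W where VW: "run (X z) T = (V, W)" by force
          then have "good_low_rank_approx k \<epsilon> (A (override C (\<lambda>_. 1) z)) V W"
            using True by (simp add: S_def X_def)
          then have "11 / 12 * card P \<le> (\<Sum>e\<in>P. s e * \<sigma> e (V, W))"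
            using decode[OF s override_signs[OF z]] True by blast
          then show ?thesis using True by (simp add: VW)
        next
          case False
          have "(\<Sum>e\<in>P. -1) \<le> (\<Sum>e\<in>P. s e * \<sigma> e (run (X z) T))"
          proof (rule sum_mono)
            fix e assume "e \<in> P"
            with s have "s e \<in> signs" by (rule PiE_mem)
            then show "-1 \<le> s e * \<sigma> e (run (X z) T)"
              using \<sigma>[of e "run (X z) T"] by (auto simp: abs_le_iff)
          qed
          then show ?thesis using False by auto
        qed
      qed
      also have "\<dots> \<le> (10 * \<eta>\<^sup>2 *
          mean (\<lambda>_. 0) C (\<lambda>s z. card (C \<inter> (\<lambda>(i, j). cell i j) ` entries_read (X z) T)) + card P / 10) / 2"
        using correlation_le_reads[where A = A and h = h and cell = cell and \<sigma> = \<sigma> and lam = 10 and \<mu> = "\<lambda>_. 0" and U = C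
            and \<rho> = "\<lambda>_. 1", OF A \<sigma> _ qw[OF T]]
        by (simp add: X_def)
      also have "\<dots> \<le> (10 * \<eta>\<^sup>2 * mean (\<lambda>_. 0) C (\<lambda>s z. num_reads (X z) T) + card P / 10) / 2"
      proof (intro divide_right_mono add_right_mono mult_left_mono mean_mono[OF zero order_refl])
        fix s z
        have fin: "finite (entries_read (X z) T)"
          using entries_read_subset[OF qw[OF T]] by (rule finite_subset) simp
        have "card (C \<inter> (\<lambda>(i, j). cell i j) ` entries_read (X z) T) \<le>
            card ((\<lambda>(i, j). cell i j) ` entries_read (X z) T)"
          using fin by (intro card_mono) auto
        also have "\<dots> \<le> num_reads (X z) T"
          unfolding num_reads_def using fin by (rule card_image_le)
        finally show "real (card (C \<inter> (\<lambda>(i, j). cell i j) ` entries_read (X z) T)) \<le> num_reads (X z) T"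
          by simp
      qed auto
      finally show ?thesis .
    qed
    have ind: "integrable M (\<lambda>T. ?ok s z * indicator (S z) T)"
      "(LINT T|M. ?ok s z * indicator (S z) T) = ?ok s z * prob (S z)" if "z \<in> PiE C (\<lambda>_. signs)" for s z
      using S(1)[OF that] by (simp_all add: emeasure_eq_measure)
    note int1 = integral_mean(1)[of C M "\<lambda>s z T. ?ok s z * indicator (S z) T" "\<lambda>_. 0", OF ind(1)]
    have "(LINT T|M. mean (\<lambda>_. 0) C (\<lambda>s z. ?ok s z * indicator (S z) T)) =
        mean (\<lambda>_. 0) C (\<lambda>s z. LINT T|M. ?ok s z * indicator (S z) T)"
      by (rule integral_mean(2)[OF ind(1)])
    also have "\<dots> = mean (\<lambda>_. 0) C (\<lambda>s z. ?ok s z * prob (S z))"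
      by (intro mean_cong ind(2))
    finally have lint1: "(LINT T|M. mean (\<lambda>_. 0) C (\<lambda>s z. ?ok s z * indicator (S z) T)) =
        mean (\<lambda>_. 0) C (\<lambda>s z. ?ok s z * prob (S z))" .
    have int2: "integrable M (\<lambda>T. mean (\<lambda>_. 0) C (\<lambda>s z. num_reads (X z) T))"
      and lint2: "(LINT T|M. mean (\<lambda>_. 0) C (\<lambda>s z. num_reads (X z) T)) =
        mean (\<lambda>_. 0) C (\<lambda>s z. expected_reads M (X z))"
      using integral_mean[of C M "\<lambda>s z T. num_reads (X z) T" "\<lambda>_. 0"] reads_int
      by (simp_all add: expected_reads_def)
    have "(LINT T|M. card P * (23 / 12 * mean (\<lambda>_. 0) C (\<lambda>s z. ?ok s z * indicator (S z) T) - 1))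
        \<le> (LINT T|M. (10 * \<eta>\<^sup>2 * mean (\<lambda>_. 0) C (\<lambda>s z. num_reads (X z) T) + card P / 10) / 2)"
      using int1 int2 pointwise
      by (intro integral_mono integrable_mult_right integrable_diff integrable_divide integrable_add) auto
    then have main: "card P * (23 / 12 * mean (\<lambda>_. 0) C (\<lambda>s z. ?ok s z * prob (S z)) - 1)
        \<le> (10 * \<eta>\<^sup>2 * mean (\<lambda>_. 0) C (\<lambda>s z. expected_reads M (X z)) + card P / 10) / 2"
      using int1 int2 by (simp add: lint1 lint2 prob_space)
    have "mean (\<lambda>_. 0) C (\<lambda>s z. expected_reads M (X z)) \<le> mean (\<lambda>_. 0) C (\<lambda>s z. ?q)"
      using few[OF X_in] by (intro mean_mono[OF zero order_refl]) (simp add: less_imp_le)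
    also have "\<dots> = ?q" by (rule mean_const[OF finite_C])
    finally have "10 * \<eta>\<^sup>2 * mean (\<lambda>_. 0) C (\<lambda>s z. expected_reads M (X z)) \<le> 10 * \<eta>\<^sup>2 * ?q"
      by (intro mult_left_mono) auto
    then have upper: "10 * \<eta>\<^sup>2 * mean (\<lambda>_. 0) C (\<lambda>s z. expected_reads M (X z)) \<le> card P / 10"
      using eta by (simp add: field_simps)
    have "2 / 3 * (9 / 10) \<le> 2 / 3 * mean (\<lambda>_. 0) C (\<lambda>s z. 1 - of_bool (\<not> typical s (override C (\<lambda>_. 1) z)))"
      using typical by (simp only: mean_diff mean_const[OF finite_C] mult_le_cancel_left_pos)
    also have "\<dots> = mean (\<lambda>_. 0) C (\<lambda>s z. 2 / 3 * ?ok s z)"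
      unfolding mean_cmult by (intro arg_cong2[where f = "(*)"] mean_cong refl) auto
    also have "\<dots> \<le> mean (\<lambda>_. 0) C (\<lambda>s z. ?ok s z * prob (S z))"
      using S(2) by (intro mean_mono[OF zero order_refl]) auto
    finally have "card P * (23 / 12 * (2 / 3 * (9 / 10)) - 1) \<le>
        card P * (23 / 12 * mean (\<lambda>_. 0) C (\<lambda>s z. ?ok s z * prob (S z)) - 1)"
      by (intro mult_left_mono) auto
    also note main
    also have "(10 * \<eta>\<^sup>2 * mean (\<lambda>_. 0) C (\<lambda>s z. expected_reads M (X z)) + card P / 10) / 2 \<le>
        (card P / 10 + card P / 10) / 2"
      using upper by (intro divide_right_mono add_right_mono) auto
    finally have "card P * (23 / 12 * (2 / 3 * (9 / 10)) - 1) \<le> (card P / 10 + card P / 10) / 2" .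
    then show False using cardP by simp
  qed
qed

end

section \<open>Noise and decoding\<close>

context sign_model
begin

lemma mean_residual_mult_eq_0:
  assumes "c \<in> U" "U \<subseteq> C" "\<And>s z v. g s (z(c := v)) = g s z"
  shows "mean \<mu> U (\<lambda>s z. (z c - \<eta> * s (par c)) * g s z) = 0"
  unfolding mean_def
proof (rule sum.neutral, rule ballI)
  fix s assume s: "s \<in> PiE P (\<lambda>_. signs)"
  have fin: "finite U" using assms(2) finite_C finite_subset by blast
  let ?t = "s (par c)" and ?q = "\<Prod>e\<in>P. (1 + \<mu> e * s e) / 2"
  let ?r = "\<lambda>z. \<Prod>d\<in>U - {c}. (1 + \<eta> * z d * s (par d)) / 2"
  have "par c \<in> P" using assms par by blast
  with s have "?t \<in> signs" by (rule PiE_mem)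
  then have zero: "(\<Sum>v\<in>signs. (1 + \<eta> * v * ?t) / 2 * (v - \<eta> * ?t)) = 0"
    by (auto simp: field_simps)
  have w: "weight \<mu> U s (z(c := v)) = ?q * ((1 + \<eta> * v * ?t) / 2 * ?r z)" for z v
    unfolding weight_def by (subst prod.remove[OF fin assms(1)]) auto
  have "(\<Sum>z\<in>PiE U (\<lambda>_. signs). weight \<mu> U s z * ((z c - \<eta> * ?t) * g s z)) =
      (\<Sum>v\<in>signs. \<Sum>z\<in>PiE (U - {c}) (\<lambda>_. signs). ((1 + \<eta> * v * ?t) / 2 * (v - \<eta> * ?t)) * (?q * ?r z * g s z))"
    by (simp only: sum_PiE_remove[OF fin assms(1)] w assms(3) fun_upd_same mult_ac)
  also have "\<dots> = (\<Sum>v\<in>signs. (1 + \<eta> * v * ?t) / 2 * (v - \<eta> * ?t)) *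
      (\<Sum>z\<in>PiE (U - {c}) (\<lambda>_. signs). ?q * ?r z * g s z)"
    by (simp only: sum_product)
  finally show "(\<Sum>z\<in>PiE U (\<lambda>_. signs). weight \<mu> U s z * ((z c - \<eta> * ?t) * g s z)) = 0"
    by (simp only: zero mult_zero_left)
qed

end

locale grid_model = sign_model P C par \<eta>
  for P :: "'e set" and C :: "(nat \<times> nat) set" and par and \<eta> +
  fixes p q :: nat
  assumes C_eq: "C = {..<p} \<times> {..<q}"
begin

definition noise :: "('e \<Rightarrow> real) \<Rightarrow> (nat \<times> nat \<Rightarrow> real) \<Rightarrow> nat \<Rightarrow> nat \<Rightarrow> real" where
  "noise s z i j = (z (i, j) - \<eta> * s (par (i, j))) / 2"

definition gram_defect :: "('e \<Rightarrow> real) \<Rightarrow> (nat \<times> nat \<Rightarrow> real) \<Rightarrow> real" where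
  "gram_defect s z = (\<Sum>j<q. \<Sum>j'\<in>{..<q} - {j}. (\<Sum>i<p. noise s z i j * noise s z i j')\<^sup>2)"

lemma abs_noise_le_1:
  assumes "s \<in> PiE P (\<lambda>_. signs)" "\<And>c. c \<in> C \<Longrightarrow> z c \<in> signs" "i < p" "j < q"
  shows "\<bar>noise s z i j\<bar> \<le> 1"
proof -
  have c: "(i, j) \<in> C" using assms C_eq by simp
  have "s (par (i, j)) \<in> signs" using PiE_mem[OF assms(1) par[OF c]] .
  with assms(2)[OF c] show ?thesis using eta by (auto simp: noise_def)
qed

lemma mean_gram_defect_le: "mean (\<lambda>_. 0) C gram_defect \<le> real q * real q * p"
proof -
  let ?M = "mean (\<lambda>_. 0) C"
  have "?M (\<lambda>s z. (\<Sum>i<p. noise s z i j * noise s z i j')\<^sup>2) \<le> p"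
    if j: "j < q" "j' < q" "j \<noteq> j'" for j j'
  proof -
    let ?a = "\<lambda>s z i. noise s z i j * noise s z i j'"
    have off: "?M (\<lambda>s z. ?a s z i * ?a s z i') = 0" if "i < p" "i' < p" "i \<noteq> i'" for i i'
    proof -
      let ?g = "\<lambda>s z. noise s z i j' * ?a s z i' / 2"
      have "?M (\<lambda>s z. ?a s z i * ?a s z i') = ?M (\<lambda>s z. (z (i, j) - \<eta> * s (par (i, j))) * ?g s z)"
        by (rule mean_cong) (simp add: noise_def)
      also have "\<dots> = 0"
        using that j by (intro mean_residual_mult_eq_0) (auto simp: C_eq noise_def)
      finally show ?thesis .
    qed
    have diag: "?M (\<lambda>s z. ?a s z i * ?a s z i) \<le> 1" if "i < p" for i
    proof -
      have "?M (\<lambda>s z. ?a s z i * ?a s z i) \<le> ?M (\<lambda>s z. 1)"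
      proof (rule mean_mono)
        fix s z assume s: "s \<in> PiE P (\<lambda>_. signs)" and z: "z \<in> PiE C (\<lambda>_. signs)"
        have "\<bar>?a s z i\<bar> \<le> 1"
          unfolding abs_mult using abs_noise_le_1[OF s PiE_mem[OF z] that] j by (intro mult_le_one) auto
        then show "?a s z i * ?a s z i \<le> 1"
          using abs_square_le_1[of "?a s z i"] by (simp add: power2_eq_square)
      qed auto
      then show ?thesis by (simp add: mean_const[OF finite_C])
    qed
    have "?M (\<lambda>s z. (\<Sum>i<p. ?a s z i)\<^sup>2) = (\<Sum>i<p. \<Sum>i'<p. ?M (\<lambda>s z. ?a s z i * ?a s z i'))"
      by (simp only: power2_eq_square sum_product mean_sum)
    also have "\<dots> \<le> (\<Sum>i<p. \<Sum>i'<p. if i' = i then 1 else 0)"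
      using off diag by (intro sum_mono) auto
    also have "\<dots> = p" by simp
    finally show ?thesis .
  qed
  then have "?M gram_defect \<le> (\<Sum>j<q. \<Sum>j'\<in>{..<q} - {j}. real p)"
    unfolding gram_defect_def mean_sum by (intro sum_mono) auto
  also have "\<dots> \<le> (\<Sum>j<q. \<Sum>j'<q. real p)"
    by (intro sum_mono sum_mono2) auto
  finally show ?thesis by simp
qed

lemma gram_defect_override: "gram_defect s (override C \<rho> z) = gram_defect s z"
  unfolding gram_defect_def noise_def override_def C_eq
  by (intro sum.cong refl arg_cong[where f = "\<lambda>x. x\<^sup>2"]) auto

lemma large_gram_defect_unlikely:
  assumes "0 < p" "0 < q"
  shows "mean (\<lambda>_. 0) C (\<lambda>s z. of_bool (\<not> gram_defect s (override C (\<lambda>_. 1) z) \<le> 10 * real q * real q * p)) \<le> 1 / 10"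
proof -
  let ?b = "10 * real q * real q * p"
  have b: "0 < ?b" using assms by simp
  have "mean (\<lambda>_. 0) C (\<lambda>s z. of_bool (\<not> gram_defect s (override C (\<lambda>_. 1) z) \<le> ?b)) \<le>
      mean (\<lambda>_. 0) C (\<lambda>s z. 1 / ?b * gram_defect s z)"
  proof (rule mean_mono)
    fix s z
    have "0 \<le> gram_defect s z" by (simp add: gram_defect_def sum_nonneg)
    then show "of_bool (\<not> gram_defect s (override C (\<lambda>_. 1) z) \<le> ?b) \<le> 1 / ?b * gram_defect s z"
      using b by (auto simp: gram_defect_override pos_le_divide_eq)
  qed auto
  also have "\<dots> \<le> 1 / ?b * (real q * real q * p)"
    unfolding mean_cmult using mean_gram_defect_le b by (intro mult_left_mono) auto
  also have "\<dots> = 1 / 10" using assms by simp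
  finally show ?thesis .
qed

lemma inner_noise_le:
  assumes "s \<in> PiE P (\<lambda>_. signs)" "\<And>c. c \<in> C \<Longrightarrow> z c \<in> signs"
    and "gram_defect s z \<le> 10 * real q * real q * p" "outer_rank r D"
  shows "\<bar>\<Sum>i<p. \<Sum>j<q. noise s z i j * D i j\<bar> \<le>
    sqrt (r * (p + q * sqrt (10 * p))) * sqrt (\<Sum>i<p. \<Sum>j<q. (D i j)\<^sup>2)"
proof -
  have "sqrt (10 * real q * real q * p) = q * sqrt (10 * p)"
  proof -
    have "10 * real q * real q * p = (real q)\<^sup>2 * (10 * p)" by (simp add: power2_eq_square)
    then show ?thesis by (simp only: real_sqrt_mult) simp
  qed
  then show ?thesis
    using norm_apply_le_gram[OF abs_noise_le_1[OF assms(1,2)] assms(3)[unfolded gram_defect_def]]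
    by (intro inner_outer_rank_le[OF assms(4)]) simp_all
qed

end

lemma approx_error_le:
  fixes E :: "nat \<Rightarrow> nat \<Rightarrow> real"
  assumes A: "A \<in> carrier_mat n m" "\<And>i j. i < n \<Longrightarrow> j < m \<Longrightarrow> \<bar>A $$ (i, j)\<bar> \<le> 2"
    and approx: "good_low_rank_approx k \<epsilon> A V W" and "0 \<le> \<epsilon>" and E: "outer_rank k E"
    and inner: "\<And>D. outer_rank (2 * k) D \<Longrightarrow>
      \<bar>\<Sum>i<n. \<Sum>j<m. (A $$ (i, j) - E i j) * D i j\<bar> \<le> G * sqrt (\<Sum>i<n. \<Sum>j<m. (D i j)\<^sup>2)"
  shows "(\<Sum>i<n. \<Sum>j<m. (E i j - (V * W) $$ (i, j))\<^sup>2) \<le> 8 * \<epsilon> * n * m + 4 * G\<^sup>2"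
proof -
  have VW: "V \<in> carrier_mat n k" "W \<in> carrier_mat k m"
    using approx A unfolding good_low_rank_approx_def by auto
  obtain F where F: "outer_rank k F" "\<And>i j. i < n \<Longrightarrow> j < m \<Longrightarrow> F i j = (V * W) $$ (i, j)"
    using outer_rank_mult_mat[OF VW] by blast
  define D where "D i j = E i j - F i j" for i j
  define X where "X = sqrt (\<Sum>i<n. \<Sum>j<m. (D i j)\<^sup>2)"
  have X2: "X\<^sup>2 = (\<Sum>i<n. \<Sum>j<m. (D i j)\<^sup>2)" unfolding X_def by (simp add: sum_nonneg)
  have "outer_rank (2 * k) D"
    using outer_rank_add[OF E outer_rank_uminus[OF F(1)]] by (simp add: D_def[abs_def] mult_2)
  note inn = inner[OF this, folded X_def]
  have frob: "(frobenius_norm B)\<^sup>2 = (\<Sum>i<n. \<Sum>j<m. (B $$ (i, j))\<^sup>2)" if "B \<in> carrier_mat n m" for B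
    using that by (simp add: frobenius_norm_def sum_nonneg)
  obtain B where B: "optimal_rank_approx k A B"
    "(frobenius_norm (A - V * W))\<^sup>2 \<le> (frobenius_norm (A - B))\<^sup>2 + \<epsilon> * (frobenius_norm A)\<^sup>2"
    using approx unfolding good_low_rank_approx_def by blast
  let ?E = "mat n m (\<lambda>(i, j). E i j)"
  have "?E \<in> rank_at_most (dim_row A) (dim_col A) k"
    using rank_le_outer_rank[OF E] A by simp
  then have "frobenius_norm (A - B) \<le> frobenius_norm (A - ?E)"
    using B(1) unfolding optimal_rank_approx_def by blast
  moreover have "0 \<le> frobenius_norm (A - B)"
    by (simp add: frobenius_norm_def sum_nonneg)
  ultimately have "(frobenius_norm (A - B))\<^sup>2 \<le> (frobenius_norm (A - ?E))\<^sup>2"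
    by (rule power_mono)
  also have "\<dots> = (\<Sum>i<n. \<Sum>j<m. (A $$ (i, j) - E i j)\<^sup>2)"
    using A(1) by (subst frob) auto
  finally have 1: "(frobenius_norm (A - B))\<^sup>2 \<le> (\<Sum>i<n. \<Sum>j<m. (A $$ (i, j) - E i j)\<^sup>2)" .
  have "(frobenius_norm A)\<^sup>2 = (\<Sum>i<n. \<Sum>j<m. (A $$ (i, j))\<^sup>2)" using A by (simp add: frob)
  also have "\<dots> \<le> (\<Sum>i<n. \<Sum>j<m. 2\<^sup>2)"
  proof (intro sum_mono)
    fix i j assume "i \<in> {..<n}" "j \<in> {..<m}"
    then have "\<bar>A $$ (i, j)\<bar> \<le> \<bar>2\<bar>" using A(2) by simp
    then show "(A $$ (i, j))\<^sup>2 \<le> 2\<^sup>2" by (simp only: abs_le_square_iff)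
  qed
  finally have 2: "\<epsilon> * (frobenius_norm A)\<^sup>2 \<le> 4 * \<epsilon> * n * m"
    using mult_left_mono[OF _ \<open>0 \<le> \<epsilon>\<close>] by (force simp: mult_ac)
  have "(frobenius_norm (A - V * W))\<^sup>2 = (\<Sum>i<n. \<Sum>j<m. (A $$ (i, j) - F i j)\<^sup>2)"
    using A(1) VW by (subst frob) (auto simp: F(2) simp del: index_mult_mat(1) intro!: sum.cong)
  also have "\<dots> = (\<Sum>i<n. \<Sum>j<m. (A $$ (i, j) - E i j)\<^sup>2 + 2 * ((A $$ (i, j) - E i j) * D i j) + (D i j)\<^sup>2)"
    by (intro sum.cong refl) (simp add: D_def power2_eq_square algebra_simps)
  also have "\<dots> = (\<Sum>i<n. \<Sum>j<m. (A $$ (i, j) - E i j)\<^sup>2) +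
      2 * (\<Sum>i<n. \<Sum>j<m. (A $$ (i, j) - E i j) * D i j) + X\<^sup>2"
    by (simp only: sum.distrib sum_distrib_left X2)
  finally have "X\<^sup>2 \<le> 4 * \<epsilon> * n * m + 2 * (G * X)"
    using 1 2 B(2) inn by linarith
  moreover have "0 \<le> (X - 2 * G)\<^sup>2" by simp
  ultimately have "X\<^sup>2 \<le> 8 * \<epsilon> * n * m + 4 * G\<^sup>2"
    by (simp add: power2_diff power_mult_distrib mult_ac)
  then show ?thesis unfolding X2 D_def by (simp add: F(2))
qed

lemma card_residue_class_ge:
  assumes "b < k" "k \<le> (q::nat)"
  shows "real q / (2 * k) \<le> card {j. j < q \<and> j mod k = b}"
proof -
  have inj: "inj_on (\<lambda>t. t * k + b) {..<q div k}" using assms by (auto intro: inj_onI)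
  have "(\<lambda>t. t * k + b) ` {..<q div k} \<subseteq> {j. j < q \<and> j mod k = b}"
  proof
    fix j assume "j \<in> (\<lambda>t. t * k + b) ` {..<q div k}"
    then obtain t where t: "t < q div k" "j = t * k + b" by blast
    then have "Suc t * k \<le> q div k * k" by (intro mult_le_mono1) simp
    also have "\<dots> \<le> q" by simp
    finally show "j \<in> {j. j < q \<and> j mod k = b}" using t assms by auto
  qed
  then have "card {..<q div k} \<le> card {j. j < q \<and> j mod k = b}"
    by (intro card_inj_on_le[OF inj]) auto
  moreover have "q \<le> 2 * k * (q div k)"
  proof -
    have "1 \<le> q div k" using assms by (simp add: div_greater_zero_iff Suc_le_eq)
    then have "k * 1 \<le> k * (q div k)" by (intro mult_le_mono2)
    moreover have "q = k * (q div k) + q mod k" "q mod k < k" using assms by auto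
    ultimately show ?thesis by linarith
  qed
  then have "real q \<le> 2 * k * real (q div k)" by (metis of_nat_le_iff of_nat_mult of_nat_numeral)
  then have "real q / (2 * k) \<le> real (q div k)" using assms by (simp add: pos_divide_le_eq mult_ac)
  ultimately show ?thesis by simp
qed

definition decode_sign :: "nat \<Rightarrow> nat \<Rightarrow> (nat \<Rightarrow> nat \<Rightarrow> real) \<Rightarrow> nat \<times> nat \<Rightarrow> real" where
  "decode_sign q k F = (\<lambda>(i, b). if 0 \<le> (\<Sum>j\<in>{j. j < q \<and> j mod k = b}. F i j - 3 / 2) then 1 else - 1)"

lemma abs_decode_sign: "\<bar>decode_sign q k F e\<bar> \<le> 1"
  by (simp add: decode_sign_def case_prod_beta)

lemma decode_sign_correct:
  fixes \<eta> :: real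
  assumes k: "0 < k" "k \<le> q" and s: "s \<in> PiE ({..<p} \<times> {..<k}) (\<lambda>_. signs)" and "0 < \<eta>"
    and err: "(\<Sum>i<p. \<Sum>j<q. (3 / 2 + \<eta> / 2 * s (i, j mod k) - F i j)\<^sup>2) \<le> p * q * \<eta>\<^sup>2 / 192"
  shows "11 / 12 * card ({..<p} \<times> {..<k}) \<le> (\<Sum>e\<in>{..<p} \<times> {..<k}. s e * decode_sign q k F e)"
proof -
  define a where "a = q * \<eta>\<^sup>2 / (16 * k)"
  have a: "0 < a" using assms by (simp add: a_def)
  let ?d = "\<lambda>i j. (3 / 2 + \<eta> / 2 * s (i, j mod k) - F i j)"
  have block: "(1 - s (i, b) * decode_sign q k F (i, b)) * a \<le> (\<Sum>j\<in>{j\<in>{..<q}. j mod k = b}. (?d i j)\<^sup>2)"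
    if "i < p" "b < k" for i b
  proof -
    let ?J = "{j. j < q \<and> j mod k = b}" and ?t = "s (i, b)"
    have J: "{j\<in>{..<q}. j mod k = b} = ?J" by auto
    define f where "f = (\<Sum>j\<in>?J. F i j - 3 / 2)"
    have t: "?t \<in> signs" using PiE_mem[OF s, of "(i, b)"] that by simp
    show ?thesis
    proof (cases "?t = decode_sign q k F (i, b)")
      case True
      then have "?t * decode_sign q k F (i, b) = 1" using t by auto
      then show ?thesis by (simp add: sum_nonneg)
    next
      case False
      define x where "x = card ?J * (\<eta> / 2)"
      have x: "0 \<le> x" using \<open>0 < \<eta>\<close> by (simp add: x_def)
      have d: "(\<Sum>j\<in>?J. 1 * ?d i j) = x * ?t - f"
        by (simp add: x_def f_def sum_subtractf sum.distrib algebra_simps)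
      from False t have wrong: "?t = 1 \<and> f < 0 \<or> ?t = -1 \<and> 0 \<le> f" and m1: "?t * decode_sign q k F (i, b) = -1"
        by (auto simp: decode_sign_def f_def split: if_splits)
      from wrong have "\<bar>x\<bar> \<le> \<bar>x * ?t - f\<bar>"
      proof (elim disjE conjE)
        assume "?t = 1" "f < 0"
        with x show ?thesis by simp
      next
        assume "?t = -1" "0 \<le> f"
        with x show ?thesis by simp
      qed
      then have "x\<^sup>2 \<le> (\<Sum>j\<in>?J. 1 * ?d i j)\<^sup>2"
        unfolding d by (simp only: abs_le_square_iff)
      also have "\<dots> \<le> (\<Sum>j\<in>?J. 1\<^sup>2) * (\<Sum>j\<in>?J. (?d i j)\<^sup>2)"
        by (rule Cauchy_Schwarz_ineq_sum)
      finally have cs: "card ?J * (card ?J * (\<eta>\<^sup>2 / 4)) \<le> card ?J * (\<Sum>j\<in>?J. (?d i j)\<^sup>2)"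
        by (simp add: x_def power_mult_distrib power2_eq_square mult_ac)
      have c: "q / (2 * k) \<le> card ?J" by (rule card_residue_class_ge[OF that(2) k(2)])
      moreover have "0 < q / (2 * k)" using k by simp
      ultimately have "0 < real (card ?J)" by linarith
      with cs have "card ?J * (\<eta>\<^sup>2 / 4) \<le> (\<Sum>j\<in>?J. (?d i j)\<^sup>2)"
        by (rule mult_left_le_imp_le)
      moreover have "q / (2 * k) * (\<eta>\<^sup>2 / 4) \<le> card ?J * (\<eta>\<^sup>2 / 4)"
        using c by (intro mult_right_mono) auto
      ultimately show ?thesis unfolding m1 J by (simp add: a_def)
    qed
  qed
  have "(\<Sum>e\<in>{..<p} \<times> {..<k}. (1 - s e * decode_sign q k F e) * a) =
      (\<Sum>i<p. \<Sum>b<k. (1 - s (i, b) * decode_sign q k F (i, b)) * a)"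
    by (simp add: sum.cartesian_product case_prod_beta)
  also have "\<dots> \<le> (\<Sum>i<p. \<Sum>b<k. \<Sum>j\<in>{j\<in>{..<q}. j mod k = b}. (?d i j)\<^sup>2)"
    using block by (intro sum_mono) auto
  also have "\<dots> = (\<Sum>i<p. \<Sum>j<q. (?d i j)\<^sup>2)"
    using k by (intro sum.cong refl sum.group) auto
  also have "\<dots> \<le> p * k / 12 * a"
    using err k by (simp add: a_def)
  finally have "(\<Sum>e\<in>{..<p} \<times> {..<k}. 1 - s e * decode_sign q k F e) * a \<le> p * k / 12 * a"
    by (simp only: sum_distrib_right)
  then have "(\<Sum>e\<in>{..<p} \<times> {..<k}. 1 - s e * decode_sign q k F e) \<le> p * k / 12"
    using a by (rule mult_right_le_imp_le)
  then show ?thesis by (simp add: sum_subtractf mult_ac)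
qed

section \<open>Hard distance matrices\<close>

lemma query_lower_bound_mono:
  "query_lower_bound n m k \<epsilon> \<A> q \<Longrightarrow> q' \<le> q \<Longrightarrow> query_lower_bound n m k \<epsilon> \<A> q'"
  unfolding query_lower_bound_def by (meson order_trans)

lemma query_lower_bound_0: "A \<in> \<A> \<Longrightarrow> query_lower_bound n m k \<epsilon> \<A> 0"
  unfolding query_lower_bound_def expected_reads_def by (auto intro!: bexI[of _ A] integral_nonneg_AE)

lemma Metric_space_one_two:
  fixes f :: "'a \<Rightarrow> 'a \<Rightarrow> real"
  assumes "\<And>a b. f a b = f b a" "\<And>a b. f a b \<in> {1..2}"
  shows "Metric_space UNIV (\<lambda>a b. if a = b then 0 else f a b)"
proof
  fix a b c
  show "0 \<le> (if a = b then 0 else f a b)" using assms(2)[of a b] by simp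
  show "(if a = b then 0 else f a b) = (if b = a then 0 else f b a)" using assms(1) by simp
  show "((if a = b then 0 else f a b) = 0) = (a = b)" using assms(2)[of a b] by auto
  show "(if a = c then 0 else f a c) \<le> (if a = b then 0 else f a b) + (if b = c then 0 else f b c)"
    using assms(2)[of a c] assms(2)[of a b] assms(2)[of b c] by auto
qed

lemma distance_matsI:
  assumes "\<And>i j. g i j \<in> {1..2}"
  shows "mat n m (\<lambda>(i, j). g i j) \<in> distance_mats n m"
proof -
  let ?f = "\<lambda>a b. if a < n \<and> n \<le> b then g a (b - n) else if b < n \<and> n \<le> a then g b (a - n) else 1"
  have "Metric_space UNIV (\<lambda>a b. if a = b then 0 else ?f a b)"
    using assms by (intro Metric_space_one_two) auto
  then show ?thesis
    unfolding distance_mats_def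
    by (intro CollectI conjI exI[of _ UNIV] exI[of _ "\<lambda>a b. if a = b then 0 else ?f a b"]
      exI[of _ "\<lambda>i. i"] exI[of _ "\<lambda>j. n + j"]) auto
qed

lemma symmetric_distance_matsI:
  assumes "\<And>i j. g i j = g j i" "\<And>i j. g i j \<in> {1..2}"
  shows "mat n n (\<lambda>(i, j). if i = j then 0 else g i j) \<in> symmetric_distance_mats n"
  unfolding symmetric_distance_mats_def using Metric_space_one_two[of g, OF assms]
  by (intro CollectI conjI exI[of _ UNIV] exI[of _ "\<lambda>a b. if a = b then 0 else g a b"]
      exI[of _ "\<lambda>i. i"]) auto

lemma distance_mats_lower_bound:
  fixes \<eta> \<epsilon> :: real and n m k :: nat
  assumes k: "0 < k" "k \<le> m" and "0 < n" and \<eta>: "0 < \<eta>" "\<eta> < 1" and \<epsilon>: "0 \<le> \<epsilon>"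
    and small: "8 * \<epsilon> * n * m + 8 * k * (n + m * sqrt (10 * n)) \<le> real n * real m * \<eta>\<^sup>2 / 192"
  shows "query_lower_bound n m k \<epsilon> (distance_mats n m) (n * k / (100 * \<eta>\<^sup>2))"
proof -
  define par where "par = (\<lambda>(i::nat, j). (i, j mod k))"
  interpret grid_model "{..<n} \<times> {..<k}" "{..<n} \<times> {..<m}" par \<eta> n m
    using k \<eta> by unfold_locales (auto simp: par_def)
  define A where "A z = mat n m (\<lambda>(i, j). 3 / 2 + z (i, j) / 2)" for z :: "nat \<times> nat \<Rightarrow> real"
  define G where "G = sqrt (real (2 * k) * (n + m * sqrt (10 * n)))"
  have "query_lower_bound n m k \<epsilon> (distance_mats n m) (card ({..<n} \<times> {..<k}) / (100 * \<eta>\<^sup>2))"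
  proof (rule query_lower_bound_of_decoding[where A = A and h = "\<lambda>_ _ v. 3 / 2 + v / 2" and cell = Pair
        and typical = "\<lambda>s z. gram_defect s z \<le> 10 * real m * real m * n"
        and \<sigma> = "\<lambda>e out. decode_sign m k (\<lambda>i j. (fst out * snd out) $$ (i, j)) e"])
    fix s :: "nat \<times> nat \<Rightarrow> real" and z V W
    assume s: "s \<in> PiE ({..<n} \<times> {..<k}) (\<lambda>_. signs)" and z: "range z \<subseteq> signs"
      and typical: "gram_defect s z \<le> 10 * real m * real m * n"
      and good: "good_low_rank_approx k \<epsilon> (A z) V W"
    have zs: "z c \<in> signs" for c using z by auto
    define E where "E i j = 3 / 2 + \<eta> / 2 * s (i, j mod k)" for i j
    have "(\<Sum>i<n. \<Sum>j<m. (E i j - (V * W) $$ (i, j))\<^sup>2) \<le> 8 * \<epsilon> * n * m + 4 * G\<^sup>2"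
    proof (rule approx_error_le[OF _ _ good \<epsilon>])
      show "A z \<in> carrier_mat n m" by (simp add: A_def)
      show "\<bar>A z $$ (i, j)\<bar> \<le> 2" if "i < n" "j < m" for i j
        using that zs[of "(i, j)"] by (auto simp: A_def)
      show "outer_rank k E"
        unfolding E_def using k outer_rank_selected_column[of "\<lambda>j. j mod k" k "\<lambda>i b. 3 / 2 + \<eta> / 2 * s (i, b)"]
        by simp
      fix D assume D: "outer_rank (2 * k) D"
      have "(\<Sum>i<n. \<Sum>j<m. (A z $$ (i, j) - E i j) * D i j) = (\<Sum>i<n. \<Sum>j<m. noise s z i j * D i j)"
        unfolding noise_def by (intro sum.cong refl) (auto simp: A_def E_def par_def diff_divide_distrib)
      then show "\<bar>\<Sum>i<n. \<Sum>j<m. (A z $$ (i, j) - E i j) * D i j\<bar> \<le> G * sqrt (\<Sum>i<n. \<Sum>j<m. (D i j)\<^sup>2)"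
        unfolding G_def using inner_noise_le[OF s zs typical D] by simp
    qed
    also have "4 * G\<^sup>2 = 8 * k * (n + m * sqrt (10 * n))"
      by (simp add: G_def)
    finally have "(\<Sum>i<n. \<Sum>j<m. (3 / 2 + \<eta> / 2 * s (i, j mod k) - (V * W) $$ (i, j))\<^sup>2) \<le> real n * real m * \<eta>\<^sup>2 / 192"
      using small by (simp add: E_def)
    from decode_sign_correct[OF k s \<eta>(1) this]
    show "11 / 12 * card ({..<n} \<times> {..<k}) \<le> (\<Sum>e\<in>{..<n} \<times> {..<k}.
        s e * decode_sign m k (\<lambda>i j. (fst (V, W) * snd (V, W)) $$ (i, j)) e)" by simp
  next
    fix z :: "nat \<times> nat \<Rightarrow> real"
    assume "range z \<subseteq> signs"
    then have "z c \<in> signs" for c by auto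
    then have "3 / 2 + z (i, j) / 2 \<in> {1..2}" for i j using insertE[of "z (i, j)"] by fastforce
    then show "A z \<in> distance_mats n m" unfolding A_def by (rule distance_matsI)
  next
    show "mean (\<lambda>_. 0) ({..<n} \<times> {..<m}) (\<lambda>s z. of_bool (\<not> gram_defect s (override ({..<n} \<times> {..<m}) (\<lambda>_. 1) z)
        \<le> 10 * real m * real m * n)) \<le> 1 / 10"
      using large_gram_defect_unlikely k \<open>0 < n\<close> by simp
  qed (auto simp: A_def abs_decode_sign)
  then show ?thesis by simp
qed

lemma sum_lessThan_add: "(\<Sum>i<p + q. f i) = (\<Sum>i<p. f i) + (\<Sum>j<q. f (p + j))"
  for f :: "nat \<Rightarrow> real"
  by (induction q) auto

text \<open>The expected value of the symmetric instance is made of four blocks. For \<open>k \<ge> 3\<close> it has rank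
  at most \<open>2 b + 1 \<le> k\<close>; for \<open>k \<le> 2\<close> one takes \<open>b = 1\<close> and replaces it by a rank-one matrix agreeing
  with it outside the top left block, which is small because there are few rows.\<close>
lemma ex_symmetric_mean:
  fixes s :: "nat \<times> nat \<Rightarrow> real" and \<eta> :: real and k b p :: nat
  assumes "0 < k" and b: "b = max 1 ((k - 1) div 2)" and \<eta>: "0 < \<eta>" "\<eta> < 1"
    and s: "\<And>i l. i < p \<Longrightarrow> l < b \<Longrightarrow> s (i, l) \<in> signs"
  obtains E where "outer_rank k E"
    "\<And>i j. i < p \<Longrightarrow> E i (p + j) = 3 / 2 + \<eta> / 2 * s (i, j mod b)"
    "\<And>i j. i < p \<Longrightarrow> E (p + j) i = 3 / 2 + \<eta> / 2 * s (i, j mod b)"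
    "\<And>i j. E (p + i) (p + j) = 3 / 2"
    "\<And>i j. i < p \<Longrightarrow> j < p \<Longrightarrow> \<bar>3 / 2 - E i j\<bar> \<le> 2 * \<eta>"
proof (cases "k \<le> 2")
  case True
  then have b1: "b = 1" using assms by auto
  define u where "u i = (if i < p then \<eta> / 3 * s (i, 0) else 0)" for i
  define E where "E i j = (3 / 2 * (1 + u i)) * (1 + u j)" for i j
  show thesis
  proof
    show "outer_rank k E"
      unfolding E_def[abs_def] using \<open>0 < k\<close> by (intro outer_rank_mono[OF outer_rank_rank_one]) auto
    fix i j
    show "\<bar>3 / 2 - E i j\<bar> \<le> 2 * \<eta>" if "i < p" "j < p"
    proof -
      have u: "\<bar>u i\<bar> \<le> \<eta> / 3" if "i < p" for i
        using s[of i 0] that b1 \<eta> by (auto simp: u_def)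
      define w where "w = u i * u j"
      have "\<bar>w\<bar> \<le> \<eta> / 3 * (\<eta> / 3)"
        unfolding w_def abs_mult using u that \<eta> by (intro mult_mono) auto
      also have "\<dots> \<le> \<eta> / 3 * (1 / 3)" using \<eta> by (intro mult_left_mono) auto
      finally have w: "\<bar>w\<bar> \<le> \<eta> / 9" by simp
      have E: "E i j = 3 / 2 + 3 / 2 * u i + 3 / 2 * u j + 3 / 2 * w"
        by (simp add: E_def w_def algebra_simps)
      note bounds = u[OF that(1), THEN abs_le_D1] u[OF that(1), THEN abs_le_D2]
        u[OF that(2), THEN abs_le_D1] u[OF that(2), THEN abs_le_D2] w[THEN abs_le_D1] w[THEN abs_le_D2]
      show ?thesis
      proof (rule abs_leI)
        show "3 / 2 - E i j \<le> 2 * \<eta>" using bounds \<eta> unfolding E by linarith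
        show "- (3 / 2 - E i j) \<le> 2 * \<eta>" using bounds \<eta> unfolding E by linarith
      qed
    qed
  qed (auto simp: E_def u_def b1 algebra_simps)
next
  case False
  then have b0: "0 < b" "1 + b + b \<le> k" using assms by auto
  define S where "S i j = of_bool (i < p) * of_bool (p \<le> j) * s (i, (j - p) mod b)" for i j
  define E where "E i j = (3 / 2 * 1 + \<eta> / 2 * 1 * S i j) + \<eta> / 2 * 1 * S j i" for i j
  have S: "outer_rank b S"
    unfolding S_def using b0 by (intro outer_rank_scale_both outer_rank_selected_column[where g = "\<lambda>j. (j - p) mod b"
      and f = "\<lambda>i l. s (i, l)"]) simp
  show thesis
  proof
    have "outer_rank (1 + b + b) E"
      unfolding E_def[abs_def]
      by (intro outer_rank_add outer_rank_rank_one outer_rank_scale_both S outer_rank_transpose[OF S])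
    then show "outer_rank k E" using b0(2) by (rule outer_rank_mono)
  qed (use \<eta> in \<open>auto simp: E_def S_def\<close>)
qed

lemma symmetric_distance_mats_lower_bound:
  fixes \<eta> \<epsilon> :: real and n p q k b :: nat
  assumes n: "n = p + q" and b: "b = max 1 ((k - 1) div 2)"
    and k: "0 < k" "b \<le> q" and "0 < p" and \<eta>: "0 < \<eta>" "\<eta> < 1" and \<epsilon>: "0 \<le> \<epsilon>"
    and small: "8 * \<epsilon> * n * n + 48 * \<eta>\<^sup>2 * (real p)\<^sup>2 + 54 * k + 96 * k * (p + q * sqrt (10 * p)) \<le> real p * real q * \<eta>\<^sup>2 / 192"
  shows "query_lower_bound n n k \<epsilon> (symmetric_distance_mats n) (p * b / (100 * \<eta>\<^sup>2))"
proof -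
  have b0: "0 < b" using b by simp
  define par where "par = (\<lambda>(i::nat, j). (i, j mod b))"
  interpret grid_model "{..<p} \<times> {..<b}" "{..<p} \<times> {..<q}" par \<eta> p q
    using b0 \<eta> by unfold_locales (auto simp: par_def)
  define g where "g z i j = (if i < p \<and> p \<le> j then 3 / 2 + z (i, j - p) / 2
      else if j < p \<and> p \<le> i then 3 / 2 + z (j, i - p) / 2 else 3 / 2)" for z :: "nat \<times> nat \<Rightarrow> real" and i j
  define A where "A z = mat n n (\<lambda>(i, j). if i = j then 0 else g z i j)" for z
  define cell where "cell i j = (if i < p \<and> p \<le> j then (i, j - p) else (j, i - p))" for i j
  define h where "h i j v = (if i < p \<and> p \<le> j \<or> j < p \<and> p \<le> i then 3 / 2 + v / 2
      else if i = j then 0 else 3 / 2)" for i j and v :: real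
  define L where "L = p + q * sqrt (10 * p)"
  have L0: "0 \<le> L" by (simp add: L_def)
  define G where "G = 2 * \<eta> * p + 3 / 2 * sqrt (2 * k) + 2 * sqrt (real (2 * k) * L)"
  have g_bounds: "g z i j \<in> {1..2}" if z: "range z \<subseteq> signs" for z i j
  proof -
    have "z c \<in> signs" for c using z by auto
    then have "3 / 2 + z c / 2 \<in> {1..2}" for c using insertE[of "z c"] by fastforce
    then show ?thesis by (auto simp: g_def simp del: atLeastAtMost_iff) auto
  qed
  have "query_lower_bound n n k \<epsilon> (symmetric_distance_mats n) (card ({..<p} \<times> {..<b}) / (100 * \<eta>\<^sup>2))"
  proof (rule query_lower_bound_of_decoding[where A = A and h = h and cell = cell
        and typical = "\<lambda>s z. gram_defect s z \<le> 10 * real q * real q * p"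
        and \<sigma> = "\<lambda>e out. decode_sign q b (\<lambda>i j. (fst out * snd out) $$ (i, p + j)) e"])
    fix s :: "nat \<times> nat \<Rightarrow> real" and z V W
    assume s: "s \<in> PiE ({..<p} \<times> {..<b}) (\<lambda>_. signs)" and z: "range z \<subseteq> signs"
      and typical: "gram_defect s z \<le> 10 * real q * real q * p"
      and good: "good_low_rank_approx k \<epsilon> (A z) V W"
    have zs: "z c \<in> signs" for c using z by auto
    have ss: "s (i, l) \<in> signs" if "i < p" "l < b" for i l
      using PiE_mem[OF s, of "(i, l)"] that by simp
    obtain E where E: "outer_rank k E"
      "\<And>i j. i < p \<Longrightarrow> E i (p + j) = 3 / 2 + \<eta> / 2 * s (i, j mod b)"
      "\<And>i j. i < p \<Longrightarrow> E (p + j) i = 3 / 2 + \<eta> / 2 * s (i, j mod b)"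
      "\<And>i j. E (p + i) (p + j) = 3 / 2"
      "\<And>i j. i < p \<Longrightarrow> j < p \<Longrightarrow> \<bar>3 / 2 - E i j\<bar> \<le> 2 * \<eta>"
      using ex_symmetric_mean[where s = s and p = p, OF k(1) b \<eta> ss] by blast
    have "(\<Sum>i<n. \<Sum>j<n. (E i j - (V * W) $$ (i, j))\<^sup>2) \<le> 8 * \<epsilon> * n * n + 4 * G\<^sup>2"
    proof (rule approx_error_le[OF _ _ good \<epsilon> E(1)])
      show "A z \<in> carrier_mat n n" by (simp add: A_def)
      show "\<bar>A z $$ (i, j)\<bar> \<le> 2" if "i < n" "j < n" for i j
        using that g_bounds[OF z, of i j] by (auto simp: A_def)
      fix D assume D: "outer_rank (2 * k) D"
      define X where "X = sqrt (\<Sum>i<n. \<Sum>j<n. (D i j)\<^sup>2)"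
      have X2: "(\<Sum>i<n. \<Sum>j<n. (D i j)\<^sup>2) = (\<Sum>i<p. \<Sum>j<p. (D i j)\<^sup>2) + (\<Sum>i<p. \<Sum>j<q. (D i (p + j))\<^sup>2) +
          (\<Sum>j<q. \<Sum>i<p. (D (p + j) i)\<^sup>2) + (\<Sum>i<q. \<Sum>j<q. (D (p + i) (p + j))\<^sup>2)"
        unfolding n by (simp add: sum_lessThan_add sum.distrib)
      have swap: "(\<Sum>j<q. \<Sum>i<p. (D (p + j) i)\<^sup>2) = (\<Sum>i<p. \<Sum>j<q. (D (p + j) i)\<^sup>2)"
        by (rule sum.swap)
      have nonneg: "0 \<le> (\<Sum>i<p. \<Sum>j<p. (D i j)\<^sup>2)" "0 \<le> (\<Sum>i<p. \<Sum>j<q. (D i (p + j))\<^sup>2)"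
        "0 \<le> (\<Sum>i<p. \<Sum>j<q. (D (p + j) i)\<^sup>2)" "0 \<le> (\<Sum>i<q. \<Sum>j<q. (D (p + i) (p + j))\<^sup>2)"
        by (simp_all add: sum_nonneg)
      have parts: "sqrt (\<Sum>i<p. \<Sum>j<p. (D i j)\<^sup>2) \<le> X" "sqrt (\<Sum>i<p. \<Sum>j<q. (D i (p + j))\<^sup>2) \<le> X"
        "sqrt (\<Sum>i<p. \<Sum>j<q. (D (p + j) i)\<^sup>2) \<le> X"
        unfolding X_def X2 swap using nonneg by (auto intro!: real_sqrt_le_mono)
      let ?T1 = "\<Sum>i<p. \<Sum>j<p. (3 / 2 - E i j) * D i j"
      let ?T2 = "\<Sum>i<n. \<Sum>j<n. of_bool (i = j) * D i j"
      let ?T3 = "\<Sum>i<p. \<Sum>j<q. noise s z i j * D i (p + j)"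
      let ?T4 = "\<Sum>i<p. \<Sum>j<q. noise s z i j * D (p + j) i"
      have "(\<Sum>i<n. \<Sum>j<n. (A z $$ (i, j) - E i j) * D i j) =
          (\<Sum>i<n. \<Sum>j<n. (g z i j - E i j) * D i j - 3 / 2 * (of_bool (i = j) * D i j))"
        by (intro sum.cong refl) (auto simp: A_def g_def algebra_simps)
      also have "\<dots> = (\<Sum>i<n. \<Sum>j<n. (g z i j - E i j) * D i j) - 3 / 2 * ?T2"
        by (simp only: sum_subtractf sum_distrib_left)
      also have "(\<Sum>i<n. \<Sum>j<n. (g z i j - E i j) * D i j) =
          (\<Sum>i<p. \<Sum>j<p. (g z i j - E i j) * D i j) + (\<Sum>i<p. \<Sum>j<q. (g z i (p + j) - E i (p + j)) * D i (p + j)) +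
          (\<Sum>j<q. \<Sum>i<p. (g z (p + j) i - E (p + j) i) * D (p + j) i) +
          (\<Sum>i<q. \<Sum>j<q. (g z (p + i) (p + j) - E (p + i) (p + j)) * D (p + i) (p + j))"
        unfolding n by (simp add: sum_lessThan_add sum.distrib)
      also have "(\<Sum>i<p. \<Sum>j<p. (g z i j - E i j) * D i j) = ?T1"
        by (intro sum.cong refl) (auto simp: g_def)
      also have "(\<Sum>i<p. \<Sum>j<q. (g z i (p + j) - E i (p + j)) * D i (p + j)) = ?T3"
        unfolding noise_def by (intro sum.cong refl) (auto simp: g_def E(2) par_def diff_divide_distrib)
      also have "(\<Sum>j<q. \<Sum>i<p. (g z (p + j) i - E (p + j) i) * D (p + j) i) = ?T4"
        unfolding noise_def
        by (subst sum.swap, intro sum.cong refl) (auto simp: g_def E(3) par_def diff_divide_distrib)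
      also have "(\<Sum>i<q. \<Sum>j<q. (g z (p + i) (p + j) - E (p + i) (p + j)) * D (p + i) (p + j)) = 0"
        by (auto simp: g_def E(4) intro!: sum.neutral)
      finally have decomp: "(\<Sum>i<n. \<Sum>j<n. (A z $$ (i, j) - E i j) * D i j) = ?T1 + ?T3 + ?T4 + 0 - 3 / 2 * ?T2" .
      have T1: "\<bar>?T1\<bar> \<le> 2 * \<eta> * p * X"
      proof -
        let ?S = "{..<p} \<times> {..<p}"
        have "?T1\<^sup>2 = (\<Sum>t\<in>?S. (3 / 2 - E (fst t) (snd t)) * D (fst t) (snd t))\<^sup>2"
          by (simp add: sum.cartesian_product case_prod_beta)
        also have "\<dots> \<le> (\<Sum>t\<in>?S. (3 / 2 - E (fst t) (snd t))\<^sup>2) * (\<Sum>t\<in>?S. (D (fst t) (snd t))\<^sup>2)"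
          by (rule Cauchy_Schwarz_ineq_sum)
        also have "\<dots> \<le> (\<Sum>t\<in>?S. (2 * \<eta>)\<^sup>2) * (\<Sum>t\<in>?S. (D (fst t) (snd t))\<^sup>2)"
        proof (intro mult_right_mono sum_mono sum_nonneg)
          fix t assume "t \<in> ?S"
          then have "\<bar>3 / 2 - E (fst t) (snd t)\<bar> \<le> \<bar>2 * \<eta>\<bar>" using E(5)[of "fst t" "snd t"] \<eta> by auto
          then show "(3 / 2 - E (fst t) (snd t))\<^sup>2 \<le> (2 * \<eta>)\<^sup>2" by (simp only: abs_le_square_iff)
        qed auto
        also have "\<dots> = (2 * \<eta> * p)\<^sup>2 * (\<Sum>i<p. \<Sum>j<p. (D i j)\<^sup>2)"
          by (simp add: sum.cartesian_product case_prod_beta power_mult_distrib power2_eq_square)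
        finally have "sqrt (?T1\<^sup>2) \<le> sqrt ((2 * \<eta> * p)\<^sup>2 * (\<Sum>i<p. \<Sum>j<p. (D i j)\<^sup>2))"
          by (rule real_sqrt_le_mono)
        also have "\<dots> = 2 * \<eta> * p * sqrt (\<Sum>i<p. \<Sum>j<p. (D i j)\<^sup>2)"
          using \<eta> by (simp add: real_sqrt_mult)
        also have "\<dots> \<le> 2 * \<eta> * p * X" using parts(1) \<eta> by (intro mult_left_mono) auto
        finally show ?thesis by simp
      qed
      have T2: "\<bar>?T2\<bar> \<le> sqrt (2 * k) * X"
      proof -
        have "(\<Sum>j<n. of_bool (i = j) * y j) = y i" if "i < n" for i and y :: "nat \<Rightarrow> real"
        proof -
          have "(\<Sum>j<n. of_bool (i = j) * y j) = (\<Sum>j<n. if j = i then y j else 0)"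
            by (intro sum.cong) auto
          then show ?thesis using that by simp
        qed
        then have "\<bar>?T2\<bar> \<le> sqrt (real (2 * k) * 1) * sqrt (\<Sum>i<n. \<Sum>j<n. (D i j)\<^sup>2)"
          by (intro inner_outer_rank_le[OF D]) auto
        then show ?thesis by (simp add: X_def)
      qed
      have T3: "\<bar>?T3\<bar> \<le> sqrt (real (2 * k) * L) * X"
        using inner_noise_le[OF s zs typical outer_rank_reindex[OF D, of "\<lambda>i. i" "\<lambda>j. p + j"]] parts(2) L0
        unfolding L_def[symmetric] by (elim order_trans) (intro mult_left_mono; simp)
      have T4: "\<bar>?T4\<bar> \<le> sqrt (real (2 * k) * L) * X"
        using inner_noise_le[OF s zs typical outer_rank_transpose[OF outer_rank_reindex[OF D, of "\<lambda>j. p + j" "\<lambda>i. i"]]]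
          parts(3) L0
        unfolding L_def[symmetric] by (elim order_trans) (intro mult_left_mono; simp)
      have "\<bar>?T1 + ?T3 + ?T4 + 0 - 3 / 2 * ?T2\<bar> \<le> \<bar>?T1\<bar> + \<bar>?T3\<bar> + \<bar>?T4\<bar> + 3 / 2 * \<bar>?T2\<bar>"
        by linarith
      also have "\<dots> \<le> 2 * \<eta> * p * X + sqrt (real (2 * k) * L) * X + sqrt (real (2 * k) * L) * X + 3 / 2 * (sqrt (2 * k) * X)"
        using T1 T2 T3 T4 by linarith
      also have "\<dots> = G * X" by (simp add: G_def distrib_right)
      finally show "\<bar>\<Sum>i<n. \<Sum>j<n. (A z $$ (i, j) - E i j) * D i j\<bar> \<le> G * sqrt (\<Sum>i<n. \<Sum>j<n. (D i j)\<^sup>2)"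
        unfolding decomp X_def .
    qed
    also have "4 * G\<^sup>2 \<le> 48 * \<eta>\<^sup>2 * (real p)\<^sup>2 + 54 * k + 96 * k * L"
    proof -
      have "(x + y + w)\<^sup>2 \<le> 3 * (x\<^sup>2 + y\<^sup>2 + w\<^sup>2)" for x y w :: real
      proof -
        have "0 \<le> (x - y)\<^sup>2 + (y - w)\<^sup>2 + (x - w)\<^sup>2" by simp
        then show ?thesis by (simp add: power2_eq_square algebra_simps)
      qed
      then have "G\<^sup>2 \<le> 3 * ((2 * \<eta> * p)\<^sup>2 + (3 / 2 * sqrt (2 * k))\<^sup>2 + (2 * sqrt (real (2 * k) * L))\<^sup>2)"
        unfolding G_def by blast
      also have "\<dots> = 3 * (4 * \<eta>\<^sup>2 * (real p)\<^sup>2 + 9 / 2 * k + 8 * k * L)"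
        using L0 by (simp add: power_mult_distrib power_divide)
      finally show ?thesis by simp
    qed
    finally have total: "(\<Sum>i<n. \<Sum>j<n. (E i j - (V * W) $$ (i, j))\<^sup>2) \<le> real p * real q * \<eta>\<^sup>2 / 192"
      using small by (simp add: L_def)
    have "(\<Sum>i<p. \<Sum>j<q. (3 / 2 + \<eta> / 2 * s (i, j mod b) - (V * W) $$ (i, p + j))\<^sup>2) =
        (\<Sum>i<p. \<Sum>j<q. (E i (p + j) - (V * W) $$ (i, p + j))\<^sup>2)"
      by (simp add: E(2))
    also have "\<dots> \<le> (\<Sum>i<p. \<Sum>j<n. (E i j - (V * W) $$ (i, j))\<^sup>2)"
      unfolding n sum_lessThan_add by (intro sum_mono) (simp add: sum_nonneg)
    also have "\<dots> \<le> (\<Sum>i<n. \<Sum>j<n. (E i j - (V * W) $$ (i, j))\<^sup>2)"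
      using n by (intro sum_mono2) (auto intro: sum_nonneg)
    finally have "(\<Sum>i<p. \<Sum>j<q. (3 / 2 + \<eta> / 2 * s (i, j mod b) - (V * W) $$ (i, p + j))\<^sup>2) \<le> real p * real q * \<eta>\<^sup>2 / 192"
      using total by simp
    from decode_sign_correct[OF b0 k(2) s \<eta>(1) this]
    show "11 / 12 * card ({..<p} \<times> {..<b}) \<le> (\<Sum>e\<in>{..<p} \<times> {..<b}.
        s e * decode_sign q b (\<lambda>i j. (fst (V, W) * snd (V, W)) $$ (i, p + j)) e)" by simp
  next
    fix z :: "nat \<times> nat \<Rightarrow> real"
    assume "range z \<subseteq> signs"
    then show "A z \<in> symmetric_distance_mats n"
      unfolding A_def by (intro symmetric_distance_matsI g_bounds) (auto simp: g_def)
  next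
    show "mean (\<lambda>_. 0) ({..<p} \<times> {..<q}) (\<lambda>s z. of_bool (\<not> gram_defect s (override ({..<p} \<times> {..<q}) (\<lambda>_. 1) z)
        \<le> 10 * real q * real q * p)) \<le> 1 / 10"
      using large_gram_defect_unlikely k b0 \<open>0 < p\<close> by simp
  qed (auto simp: A_def g_def h_def cell_def abs_decode_sign)
  then show ?thesis by simp
qed

lemma distance_mats_numeric:
  fixes K \<epsilon> L :: real and n m k :: nat
  assumes K: "0 < K" and \<epsilon>: "0 < \<epsilon>" and km: "k \<le> \<epsilon> * K * m" and kn: "k \<le> \<epsilon> * K * sqrt n"
    and L: "192 * (8 + 40 * K) \<le> L"
  shows "8 * \<epsilon> * n * m + 8 * k * (n + m * sqrt (10 * n)) \<le> real n * real m * (L * \<epsilon>) / 192"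
proof -
  have s: "sqrt (10 * n) \<le> 4 * sqrt n"
    by (rule real_le_lsqrt) (simp_all add: power_mult_distrib)
  have 1: "real k * n \<le> \<epsilon> * K * m * n" using km by (rule mult_right_mono) simp
  have "real k * (m * sqrt (10 * n)) \<le> (\<epsilon> * K * sqrt n) * (m * (4 * sqrt n))"
    using kn s K \<epsilon> by (intro mult_mono mult_left_mono) auto
  also have "\<dots> = 4 * (\<epsilon> * K * m * n)"
    by (simp add: mult_ac flip: power2_eq_square)
  finally have 2: "real k * (m * sqrt (10 * n)) \<le> 4 * (\<epsilon> * K * m * n)" .
  have "8 * \<epsilon> * n * m + 8 * k * (n + m * sqrt (10 * n)) =
      8 * (\<epsilon> * n * m) + 8 * (real k * n) + 8 * (real k * (m * sqrt (10 * n)))"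
    by (simp add: algebra_simps)
  also have "\<dots> \<le> 8 * (\<epsilon> * n * m) + 8 * (\<epsilon> * K * m * n) + 8 * (4 * (\<epsilon> * K * m * n))"
    using 1 2 by linarith
  also have "\<dots> = (8 + 40 * K) * (\<epsilon> * n * m)" by (simp add: algebra_simps)
  also have "\<dots> \<le> L / 192 * (\<epsilon> * n * m)"
    using L \<epsilon> by (intro mult_right_mono) auto
  finally show ?thesis by (simp add: mult_ac)
qed

lemma symmetric_distance_mats_numeric:
  fixes K \<epsilon> L :: real and n p q k :: nat
  assumes K: "0 < K" and \<epsilon>: "0 < \<epsilon>" and km: "k \<le> \<epsilon> * K * n" and kn: "k \<le> \<epsilon> * K * sqrt n"
    and L: "2 ^ 18 * 384 * (8 + 534 * K) \<le> L"
    and n: "n = p + q" "n \<le> 2 ^ 17 * p" "65535 * p \<le> q"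
  shows "8 * \<epsilon> * n * n + 48 * (L * \<epsilon>) * (real p)\<^sup>2 + 54 * k + 96 * k * (p + q * sqrt (10 * p))
    \<le> real p * real q * (L * \<epsilon>) / 192"
proof -
  have L0: "0 < L * \<epsilon>" using L K \<epsilon> by (intro mult_pos_pos) auto
  have "n \<le> n * n" by (cases n) auto
  then have "real n \<le> real (n * n)" by (rule of_nat_mono)
  then have pn: "real p \<le> n" "real q \<le> n" "real n \<le> real n * n" using n(1) by auto
  have pq: "real n * n \<le> 2 ^ 18 * (real p * q)"
  proof -
    have "n * n \<le> 2 ^ 17 * p * (2 * q)" using n by (intro mult_le_mono) auto
    then have "real (n * n) \<le> real (2 ^ 17 * p * (2 * q))" by (rule of_nat_mono)
    then show ?thesis by (simp add: mult_ac)
  qed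
  have s: "sqrt (10 * p) \<le> 4 * sqrt n"
    using pn by (intro real_le_lsqrt) (simp_all add: power_mult_distrib)
  have 0: "real k \<le> K * (\<epsilon> * n * n)"
  proof -
    have "\<epsilon> * K * n \<le> \<epsilon> * K * (real n * n)" using pn(3) K \<epsilon> by (intro mult_left_mono) auto
    with km show ?thesis by (simp add: mult_ac)
  qed
  have 1: "real k * p \<le> K * (\<epsilon> * n * n)"
  proof -
    have "real k * p \<le> (\<epsilon> * K * n) * n" using km pn by (intro mult_mono) auto
    then show ?thesis by (simp add: mult_ac)
  qed
  have "real k * (q * sqrt (10 * p)) \<le> (\<epsilon> * K * sqrt n) * (n * (4 * sqrt n))"
    using kn s pn K \<epsilon> by (intro mult_mono) auto
  also have "\<dots> = 4 * (K * (\<epsilon> * n * n))"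
    by (simp add: mult_ac)
  finally have 2: "real k * (q * sqrt (10 * p)) \<le> 4 * (K * (\<epsilon> * n * n))" .
  have "48 * 384 * real p * p \<le> 1 * real q * p" using n(3) by (intro mult_right_mono) auto
  then have "(48 * 384 * real p * p) * (L * \<epsilon>) \<le> (1 * real q * p) * (L * \<epsilon>)"
    by (rule mult_right_mono) (use L0 in linarith)
  then have 3: "48 * (L * \<epsilon>) * (real p)\<^sup>2 \<le> real p * real q * (L * \<epsilon>) / 384"
    by (simp add: power2_eq_square mult_ac)
  have "8 * \<epsilon> * n * n + 54 * k + 96 * k * (p + q * sqrt (10 * p)) =
      8 * (\<epsilon> * n * n) + 54 * real k + 96 * (real k * p) + 96 * (real k * (q * sqrt (10 * p)))"
    by (simp add: algebra_simps)
  also have "\<dots> \<le> 8 * (\<epsilon> * n * n) + 54 * (K * (\<epsilon> * n * n)) + 96 * (K * (\<epsilon> * n * n)) + 96 * (4 * (K * (\<epsilon> * n * n)))"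
    using 0 1 2 by linarith
  also have "\<dots> = (8 + 534 * K) * \<epsilon> * (real n * n)" by (simp add: algebra_simps)
  also have "\<dots> \<le> (8 + 534 * K) * \<epsilon> * (2 ^ 18 * (real p * q))"
    using pq K \<epsilon> by (intro mult_left_mono) auto
  also have "\<dots> = 2 ^ 18 * 384 * (8 + 534 * K) * (\<epsilon> * (real p * q) / 384)" by simp
  also have "\<dots> \<le> L * (\<epsilon> * (real p * q) / 384)"
    using L \<epsilon> by (intro mult_right_mono) auto
  finally have "8 * \<epsilon> * n * n + 54 * k + 96 * k * (p + q * sqrt (10 * p)) \<le> real p * real q * (L * \<epsilon>) / 384"
    by (simp add: mult_ac)
  with 3 show ?thesis by simp
qed

theorem theorem1p3:
  fixes K :: real
  assumes "K > 0"
  shows "\<exists>\<epsilon>0 > 0. \<exists>c > 0. \<forall>(k::nat) (m::nat) (n::nat) (\<epsilon>::real).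
    k \<le> m \<and> m \<le> n \<and> 0 < \<epsilon> \<and> \<epsilon> \<le> \<epsilon>0 \<and>
    real k / \<epsilon> \<le> K * min (real m) (real n powr (1 / 3)) \<longrightarrow>
      query_lower_bound n m k \<epsilon> (distance_mats n m) (c * (real (n + m) * real k / \<epsilon>)) \<and>
      (n = m \<longrightarrow>
        query_lower_bound n n k \<epsilon> (symmetric_distance_mats n) (c * (real (n + n) * real k / \<epsilon>)))"
proof -
  define L where "L = 2 ^ 18 * 384 * (8 + 534 * K)"
  define \<epsilon>0 where "\<epsilon>0 = min (1 / (4 * L)) (1 / (65536 * K))"
  define c where "c = 1 / (2 ^ 20 * 100 * L)"
  have L: "0 < L" using assms by (simp add: L_def)
  have "0 < \<epsilon>0" "0 < c" using L assms by (simp_all add: \<epsilon>0_def c_def)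
  moreover have "query_lower_bound n m k \<epsilon> (distance_mats n m) (c * (real (n + m) * real k / \<epsilon>)) \<and>
      (n = m \<longrightarrow>
        query_lower_bound n n k \<epsilon> (symmetric_distance_mats n) (c * (real (n + n) * real k / \<epsilon>)))"
    if hyps: "k \<le> m" "m \<le> n" "0 < \<epsilon>" "\<epsilon> \<le> \<epsilon>0" "real k / \<epsilon> \<le> K * min (real m) (real n powr (1 / 3))"
    for k m n :: nat and \<epsilon> :: real
  proof (cases "k = 0")
    case True
    have "mat n m (\<lambda>(i, j). 1) \<in> distance_mats n m"
      by (rule distance_matsI[of "\<lambda>_ _. 1"]) simp
    moreover have "mat n n (\<lambda>(i, j). if i = j then 0 else 1) \<in> symmetric_distance_mats n"
      by (rule symmetric_distance_matsI[of "\<lambda>_ _. 1"]) auto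
    ultimately show ?thesis using True by (auto intro: query_lower_bound_0)
  next
    case False
    then have k: "0 < k" by simp
    then have n: "0 < n" using hyps by simp
    have kK: "k \<le> \<epsilon> * (K * min (real m) (real n powr (1 / 3)))"
      using hyps(3,5) by (simp add: pos_divide_le_eq mult_ac)
    have "\<epsilon> * (K * min (real m) (real n powr (1 / 3))) \<le> \<epsilon> * (K * m)"
      using assms hyps(3) by (intro mult_left_mono) auto
    with kK have km: "k \<le> \<epsilon> * K * m" by (simp add: mult_ac)
    have "\<epsilon> * (K * min (real m) (real n powr (1 / 3))) \<le> \<epsilon> * (K * sqrt n)"
    proof -
      have "real n powr (1 / 3) \<le> real n powr (1 / 2)" using n by (intro powr_mono) auto
      then show ?thesis using assms hyps(3) n by (intro mult_left_mono) (auto simp: powr_half_sqrt)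
    qed
    with kK have kn: "k \<le> \<epsilon> * K * sqrt n" by (simp add: mult_ac)
    define \<eta> where "\<eta> = sqrt (L * \<epsilon>)"
    have \<eta>2: "\<eta>\<^sup>2 = L * \<epsilon>" using L hyps(3) by (simp add: \<eta>_def)
    have \<eta>: "0 < \<eta>" using L hyps(3) by (simp add: \<eta>_def)
    have "L * \<epsilon> \<le> L * (1 / (4 * L))" using hyps(4) L by (intro mult_left_mono) (auto simp: \<epsilon>0_def)
    also have "\<dots> < 1" using L by simp
    finally have \<eta>1: "\<eta> < 1" by (simp add: \<eta>_def)
    have "8 * \<epsilon> * n * m + 8 * k * (n + m * sqrt (10 * n)) \<le> real n * real m * \<eta>\<^sup>2 / 192"
      unfolding \<eta>2 using assms by (intro distance_mats_numeric[OF assms hyps(3) km kn]) (simp add: L_def)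
    then have "query_lower_bound n m k \<epsilon> (distance_mats n m) (n * k / (100 * \<eta>\<^sup>2))"
      using k hyps n \<eta> \<eta>1 by (intro distance_mats_lower_bound) auto
    moreover have "c * (real (n + m) * real k / \<epsilon>) \<le> n * k / (100 * \<eta>\<^sup>2)"
    proof -
      have "c * (real (n + m) * real k / \<epsilon>) \<le> 1 / (200 * L) * (real (n + n) * real k / \<epsilon>)"
        unfolding c_def using L hyps(2,3)
        by (intro mult_mono divide_right_mono mult_right_mono frac_le) auto
      also have "\<dots> = n * k / (100 * \<eta>\<^sup>2)" by (simp add: \<eta>2 mult_ac)
      finally show ?thesis .
    qed
    ultimately have general: "query_lower_bound n m k \<epsilon> (distance_mats n m) (c * (real (n + m) * real k / \<epsilon>))"
      by (rule query_lower_bound_mono)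
    have "query_lower_bound n n k \<epsilon> (symmetric_distance_mats n) (c * (real (n + n) * real k / \<epsilon>))" if "n = m"
    proof -
      define p where "p = n div 65536"
      define q where "q = n - p"
      define b where "b = max 1 ((k - 1) div 2)"
      have "1 \<le> \<epsilon> * K * n" using km k that by simp
      also have "\<dots> \<le> 1 / (65536 * K) * K * n"
        using hyps(4) assms by (intro mult_right_mono) (auto simp: \<epsilon>0_def)
      finally have "65536 \<le> real n" using assms by simp
      then have n_large: "65536 \<le> n" by simp
      have mod: "n = 65536 * p + n mod 65536" "n mod 65536 < 65536" by (simp_all add: p_def)
      have npq: "n = p + q" by (simp add: q_def p_def)
      have p0: "0 < p" using mod n_large by linarith
      then have pn: "n \<le> 2 ^ 17 * p" using mod by simp
      have pq: "65535 * p \<le> q" using mod(1) npq by linarith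
      have "b \<le> q"
        using p0 pq npq hyps(1) that by (auto simp: b_def)
      have b: "k \<le> 4 * b" using k by (auto simp: b_def)
      have "8 * \<epsilon> * n * n + 48 * \<eta>\<^sup>2 * (real p)\<^sup>2 + 54 * k + 96 * k * (p + q * sqrt (10 * p))
          \<le> real p * real q * \<eta>\<^sup>2 / 192"
        unfolding \<eta>2 using km that
        by (intro symmetric_distance_mats_numeric[OF assms hyps(3) _ kn _ npq pn pq]) (simp_all add: L_def)
      then have "query_lower_bound n n k \<epsilon> (symmetric_distance_mats n) (p * b / (100 * \<eta>\<^sup>2))"
        using hyps(3) by (intro symmetric_distance_mats_lower_bound[OF npq b_def k \<open>b \<le> q\<close> p0 \<eta> \<eta>1]) auto
      moreover have "c * (real (n + n) * real k / \<epsilon>) \<le> p * b / (100 * \<eta>\<^sup>2)"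
      proof -
        have "real (n * k) \<le> real (2 ^ 17 * p * (4 * b))"
          using pn b by (intro of_nat_mono mult_le_mono)
        then have "real n * real k / (2 ^ 19 * 100 * L * \<epsilon>) \<le> (2 ^ 19 * (real p * b)) / (2 ^ 19 * 100 * L * \<epsilon>)"
          using L hyps(3) by (intro divide_right_mono) auto
        then show ?thesis by (simp add: c_def \<eta>2 mult_ac)
      qed
      ultimately show ?thesis by (rule query_lower_bound_mono)
    qed
    with general show ?thesis by blast
  qed
  ultimately show ?thesis by blast
qed

end
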